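(* Let $\mathfrak{g}$ be a complex semi-simple Lie algebra of rank $r$ and $V(\lambda)$ a fixed irreducible representation of $\mathfrak{g}$ with weight multiplicity function $m_\lambda$. Let $m_{\lambda,N}$ be the weight multiplicity function of the $N$-th symmetric power $S^NV(\lambda)$, and let $\mu\in X$ be a fixed weight. Then $$m_{\lambda,N}(\mu)=\frac{1}{(2\pi)^r}\int_{T^r}q^{-\mu}\sum_{\nu\in X}q^{N\nu}\sum_{k=1}^{m_\lambda(\nu)}A_{\nu,k}(q)\cdot p_k(N)\,dx.$$ In particular, the multiplicity $m_{\lambda,N}(\mu)$ equals the constant term of the function $\operatorname{Char}S^NV(\lambda)(ix)$ shifted by $q^{-\mu}$, i.e. the constant term of the Laurent polynomial $q^{-\mu}\operatorname{Char}S^NV(\lambda)(ix)$ in $q_1,\ldots,q_r$.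
   Context: $X=\bigoplus_{i=1}^r\mathbb{Z}\omega_i$ is the weight lattice of $\mathfrak{g}$ (with respect to a fixed Cartan subalgebra $\mathfrak{h}$ and Borel subalgebra), spanned by the fundamental weights; $\mathfrak{h}_{\mathbb{R}}$ is the real span of the simple coroots $\alpha_1^\vee,\ldots,\alpha_r^\vee$. $V(\lambda)$ is the irreducible representation of highest weight $\lambda$ (dominant), $m_\lambda(\nu)=\dim V(\lambda)_\nu$, and $m_{\lambda,N}(\nu)$ is the dimension of the $\nu$-weight space of $S^NV(\lambda)$, $N\in\mathbb{N}=\{0,1,2,\ldots\}$. For $x=\sum_j x_j\alpha_j^\vee\in\mathfrak{h}_{\mathbb{R}}$ write $q_j=e^{ix_j}$, and for $\mu=c_1\omega_1+\cdots+c_r\omega_r$ write $q^\mu=q_1^{c_1}\cdots q_r^{c_r}=e^{i\langle\mu,x\rangle}$. $\operatorname{Char}S^NV(\lambda)(ix)=\sum_{\nu\in X}m_{\lambda,N}(\nu)q^\nu$. $T^r=\mathfrak{h}_{\mathbb{R}}/2\pi X^*$, where $X^*\subset\mathfrak{h}_{\mathbb{R}}$ is the lattice dual to $X$ (spanned by the simple coroots), and $dx$ is Lebesgue measure normalized so that $T^r$ has volume $(2\pi)^r$. The polynomials $p_k(N)=\binom{N+k-1}{N}$ have degree $k-1$ in $N$. The rational functions $A_{\nu,k}(q)\in\mathbb{C}(q_1,\ldots,q_r)$, $1\le k\le m_\lambda(\nu)$, are the coefficients of the partial fraction decomposition with respect to $z$ $$\prod_{\nu\in X}\frac{1}{(1-q^\nu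 z)^{m_\lambda(\nu)}}=\sum_{\nu\in X}\sum_{k=1}^{m_\lambda(\nu)}A_{\nu,k}(q)\frac{1}{(1-q^\nu z)^k};$$ explicitly, for $\nu\in X$ and $l=0,\ldots,m_\lambda(\nu)-1$, $$A_{\nu,m_\lambda(\nu)-l}(q)=\frac{(-1)^l}{l!\,q^{l\nu}}\frac{d^l}{(dz)^l}\left[\prod_{\nu'\in X\setminus\{\nu\}}\frac{1}{(1-q^{\nu'}z)^{m_\lambda(\nu')}}\right]_{z=q^{-\nu}}.$$ The integrand is the total sum, a rational function in $q_1,\ldots,q_r$, viewed as a function of $x\in T^r$ (the individual summands are defined for almost every $x$). Sums and products over $X$ are effectively finite. *)

theory Defs
  imports "HOL-Analysis.Analysis" "HOL-Library.Poly_Mapping"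
begin

text \<open>
  Lie algebras and representations live on whole types, with scalar multiplication, bracket and
  action passed explicitly. Linear forms on a Cartan subalgebra \<open>H\<close> are functions on the
  Lie algebra of which only the values on \<open>H\<close> matter.
\<close>

section \<open>Lie algebras\<close>

definition finite_dim :: "(complex \<Rightarrow> 'a::ab_group_add \<Rightarrow> 'a) \<Rightarrow> bool" where
  "finite_dim s \<longleftrightarrow> (\<exists>E. finite E \<and> module.span s E = UNIV)"

definition lie_algebra ::
  "(complex \<Rightarrow> 'g::ab_group_add \<Rightarrow> 'g) \<Rightarrow> ('g \<Rightarrow> 'g \<Rightarrow> 'g) \<Rightarrow> bool" where
  "lie_algebra s br \<longleftrightarrow>
     vector_space s \<and>
     (\<forall>x. Vector_Spaces.linear s s (\<lambda>y. br x y)) \<and>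
     (\<forall>y. Vector_Spaces.linear s s (\<lambda>x. br x y)) \<and>
     (\<forall>x. br x x = 0) \<and>
     (\<forall>x y z. br x (br y z) + br y (br z x) + br z (br x y) = 0)"

definition subalgebra ::
  "(complex \<Rightarrow> 'g::ab_group_add \<Rightarrow> 'g) \<Rightarrow> ('g \<Rightarrow> 'g \<Rightarrow> 'g) \<Rightarrow> 'g set \<Rightarrow> bool" where
  "subalgebra s br A \<longleftrightarrow> module.subspace s A \<and> (\<forall>x\<in>A. \<forall>y\<in>A. br x y \<in> A)"

definition lie_ideal ::
  "(complex \<Rightarrow> 'g::ab_group_add \<Rightarrow> 'g) \<Rightarrow> ('g \<Rightarrow> 'g \<Rightarrow> 'g) \<Rightarrow> 'g set \<Rightarrow> bool" where
  "lie_ideal s br I \<longleftrightarrow> module.subspace s I \<and> (\<forall>x. \<forall>y\<in>I. br x y \<in> I)"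

primrec derived_series ::
  "(complex \<Rightarrow> 'g::ab_group_add \<Rightarrow> 'g) \<Rightarrow> ('g \<Rightarrow> 'g \<Rightarrow> 'g) \<Rightarrow> 'g set \<Rightarrow> nat \<Rightarrow> 'g set" where
  "derived_series s br A 0 = A"
| "derived_series s br A (Suc n) =
     module.span s {br x y | x y. x \<in> derived_series s br A n \<and> y \<in> derived_series s br A n}"

definition solvable ::
  "(complex \<Rightarrow> 'g::ab_group_add \<Rightarrow> 'g) \<Rightarrow> ('g \<Rightarrow> 'g \<Rightarrow> 'g) \<Rightarrow> 'g set \<Rightarrow> bool" where
  "solvable s br A \<longleftrightarrow> (\<exists>n. derived_series s br A n = {0})"

definition semisimple_lie_algebra ::
  "(complex \<Rightarrow> 'g::ab_group_add \<Rightarrow> 'g) \<Rightarrow> ('g \<Rightarrow> 'g \<Rightarrow> 'g) \<Rightarrow> bool" where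
  "semisimple_lie_algebra s br \<longleftrightarrow>
     lie_algebra s br \<and> finite_dim s \<and>
     (\<forall>I. lie_ideal s br I \<and> solvable s br I \<longrightarrow> I = {0})"

definition diagonalizable ::
  "(complex \<Rightarrow> 'a::ab_group_add \<Rightarrow> 'a) \<Rightarrow> ('a \<Rightarrow> 'a) \<Rightarrow> bool" where
  "diagonalizable s T \<longleftrightarrow> module.span s {v. \<exists>c. T v = s c v} = UNIV"

text \<open>
  The usual notion for semisimple Lie algebras: a maximal commutative subalgebra (for a commutative
  subspace, maximality means that it contains everything commuting with it) all of whose elements
  are ad-diagonalizable.
\<close>

definition cartan_subalgebra ::
  "(complex \<Rightarrow> 'g::ab_group_add \<Rightarrow> 'g) \<Rightarrow> ('g \<Rightarrow> 'g \<Rightarrow> 'g) \<Rightarrow> 'g set \<Rightarrow> bool" where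
  "cartan_subalgebra s br H \<longleftrightarrow>
     module.subspace s H \<and>
     (\<forall>x\<in>H. \<forall>y\<in>H. br x y = 0) \<and>
     (\<forall>x. (\<forall>h\<in>H. br h x = 0) \<longrightarrow> x \<in> H) \<and>
     (\<forall>h\<in>H. diagonalizable s (br h))"

definition borel_subalgebra ::
  "(complex \<Rightarrow> 'g::ab_group_add \<Rightarrow> 'g) \<Rightarrow> ('g \<Rightarrow> 'g \<Rightarrow> 'g) \<Rightarrow> 'g set \<Rightarrow> bool" where
  "borel_subalgebra s br B \<longleftrightarrow>
     subalgebra s br B \<and> solvable s br B \<and>
     (\<forall>B'. subalgebra s br B' \<and> solvable s br B' \<and> B \<subseteq> B' \<longrightarrow> B' = B)"


section \<open>Representations, roots and weights\<close>

definition lie_representation ::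
  "(complex \<Rightarrow> 'g::ab_group_add \<Rightarrow> 'g) \<Rightarrow> ('g \<Rightarrow> 'g \<Rightarrow> 'g) \<Rightarrow>
   (complex \<Rightarrow> 'v::ab_group_add \<Rightarrow> 'v) \<Rightarrow> ('g \<Rightarrow> 'v \<Rightarrow> 'v) \<Rightarrow> bool" where
  "lie_representation s br sV \<rho> \<longleftrightarrow>
     vector_space sV \<and> finite_dim sV \<and>
     (\<forall>x. Vector_Spaces.linear sV sV (\<lambda>v. \<rho> x v)) \<and>
     (\<forall>v. Vector_Spaces.linear s sV (\<lambda>x. \<rho> x v)) \<and>
     (\<forall>x y v. \<rho> (br x y) v = \<rho> x (\<rho> y v) - \<rho> y (\<rho> x v))"

definition irreducible_rep ::
  "(complex \<Rightarrow> 'v::ab_group_add \<Rightarrow> 'v) \<Rightarrow> ('g \<Rightarrow> 'v \<Rightarrow> 'v) \<Rightarrow> bool" where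
  "irreducible_rep sV \<rho> \<longleftrightarrow>
     (\<exists>v::'v. v \<noteq> 0) \<and>
     (\<forall>W. module.subspace sV W \<and> (\<forall>x. \<forall>w\<in>W. \<rho> x w \<in> W) \<longrightarrow> W = {0} \<or> W = UNIV)"

definition weight_space ::
  "(complex \<Rightarrow> 'v::ab_group_add \<Rightarrow> 'v) \<Rightarrow> ('g \<Rightarrow> 'v \<Rightarrow> 'v) \<Rightarrow> 'g set \<Rightarrow> ('g \<Rightarrow> complex) \<Rightarrow> 'v set" where
  "weight_space sV \<rho> H \<phi> = {v. \<forall>h\<in>H. \<rho> h v = sV (\<phi> h) v}"

definition linear_form_on ::
  "(complex \<Rightarrow> 'g::ab_group_add \<Rightarrow> 'g) \<Rightarrow> 'g set \<Rightarrow> ('g \<Rightarrow> complex) \<Rightarrow> bool" where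
  "linear_form_on s H \<phi> \<longleftrightarrow>
     (\<forall>x\<in>H. \<forall>y\<in>H. \<phi> (x + y) = \<phi> x + \<phi> y) \<and> (\<forall>c. \<forall>x\<in>H. \<phi> (s c x) = c * \<phi> x)"

abbreviation root_space ::
  "(complex \<Rightarrow> 'g::ab_group_add \<Rightarrow> 'g) \<Rightarrow> ('g \<Rightarrow> 'g \<Rightarrow> 'g) \<Rightarrow> 'g set \<Rightarrow> ('g \<Rightarrow> complex) \<Rightarrow> 'g set" where
  "root_space s br H \<beta> \<equiv> weight_space s br H \<beta>"

definition is_root ::
  "(complex \<Rightarrow> 'g::ab_group_add \<Rightarrow> 'g) \<Rightarrow> ('g \<Rightarrow> 'g \<Rightarrow> 'g) \<Rightarrow> 'g set \<Rightarrow> ('g \<Rightarrow> complex) \<Rightarrow> bool" where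
  "is_root s br H \<beta> \<longleftrightarrow>
     linear_form_on s H \<beta> \<and> (\<exists>h\<in>H. \<beta> h \<noteq> 0) \<and> root_space s br H \<beta> \<noteq> {0}"

definition positive_root ::
  "(complex \<Rightarrow> 'g::ab_group_add \<Rightarrow> 'g) \<Rightarrow> ('g \<Rightarrow> 'g \<Rightarrow> 'g) \<Rightarrow> 'g set \<Rightarrow> 'g set \<Rightarrow>
   ('g \<Rightarrow> complex) \<Rightarrow> bool" where
  "positive_root s br H B \<beta> \<longleftrightarrow> is_root s br H \<beta> \<and> root_space s br H \<beta> \<subseteq> B"

text \<open>\<open>\<alpha> 0, \<dots>, \<alpha> (r - 1)\<close> is the base of the root system of \<open>H\<close>
  whose positive roots are those of the Borel subalgebra \<open>B\<close>.\<close>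

definition simple_roots ::
  "(complex \<Rightarrow> 'g::ab_group_add \<Rightarrow> 'g) \<Rightarrow> ('g \<Rightarrow> 'g \<Rightarrow> 'g) \<Rightarrow> 'g set \<Rightarrow> 'g set \<Rightarrow> nat \<Rightarrow>
   (nat \<Rightarrow> 'g \<Rightarrow> complex) \<Rightarrow> bool" where
  "simple_roots s br H B r \<alpha> \<longleftrightarrow>
     (\<forall>j<r. positive_root s br H B (\<alpha> j)) \<and>
     (\<forall>c::nat \<Rightarrow> complex. (\<forall>h\<in>H. (\<Sum>j<r. c j * \<alpha> j h) = 0) \<longrightarrow> (\<forall>j<r. c j = 0)) \<and>
     (\<forall>\<beta>. positive_root s br H B \<beta> \<longrightarrow>
        (\<exists>n::nat \<Rightarrow> nat. \<forall>h\<in>H. \<beta> h = (\<Sum>j<r. of_nat (n j) * \<alpha> j h)))"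

text \<open>The coroot of \<open>\<beta>\<close> is the unique \<open>t\<close> of the form \<open>[e, f]\<close>
  with \<open>e\<close>, \<open>f\<close> in the root spaces of \<open>\<beta>\<close>, \<open>-\<beta>\<close> and \<open>\<beta> t = 2\<close>
  (so that \<open>e, t, f\<close> is an sl2-triple).\<close>

definition is_coroot ::
  "(complex \<Rightarrow> 'g::ab_group_add \<Rightarrow> 'g) \<Rightarrow> ('g \<Rightarrow> 'g \<Rightarrow> 'g) \<Rightarrow> 'g set \<Rightarrow> ('g \<Rightarrow> complex) \<Rightarrow>
   'g \<Rightarrow> bool" where
  "is_coroot s br H \<beta> t \<longleftrightarrow>
     t \<in> H \<and> \<beta> t = 2 \<and>
     (\<exists>e \<in> root_space s br H \<beta>. \<exists>f \<in> root_space s br H (\<lambda>h. - \<beta> h). br e f = t)"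

definition fundamental_weights ::
  "(complex \<Rightarrow> 'g::ab_group_add \<Rightarrow> 'g) \<Rightarrow> 'g set \<Rightarrow> nat \<Rightarrow> (nat \<Rightarrow> 'g) \<Rightarrow>
   (nat \<Rightarrow> 'g \<Rightarrow> complex) \<Rightarrow> bool" where
  "fundamental_weights s H r \<alpha>c \<omega> \<longleftrightarrow>
     (\<forall>i<r. linear_form_on s H (\<omega> i)) \<and>
     (\<forall>i<r. \<forall>j<r. \<omega> i (\<alpha>c j) = (if i = j then 1 else 0))"

text \<open>The weight lattice is represented by coordinates: \<open>c\<close> stands for
  \<open>c\<^sub>0 \<omega>\<^sub>0 + \<dots> + c\<^bsub>r-1\<^esub> \<omega>\<^bsub>r-1\<^esub>\<close>,
  the linear form \<open>weight_form \<omega> r c\<close>.\<close>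

definition weight_lattice :: "nat \<Rightarrow> (nat \<Rightarrow> int) set" where
  "weight_lattice r = {c. \<forall>j\<ge>r. c j = 0}"

definition weight_form :: "(nat \<Rightarrow> 'g \<Rightarrow> complex) \<Rightarrow> nat \<Rightarrow> (nat \<Rightarrow> int) \<Rightarrow> 'g \<Rightarrow> complex" where
  "weight_form \<omega> r c h = (\<Sum>j<r. of_int (c j) * \<omega> j h)"

definition dominant :: "nat \<Rightarrow> (nat \<Rightarrow> int) \<Rightarrow> bool" where
  "dominant r c \<longleftrightarrow> (\<forall>j<r. c j \<ge> 0)"

definition has_highest_weight ::
  "(complex \<Rightarrow> 'g::ab_group_add \<Rightarrow> 'g) \<Rightarrow> ('g \<Rightarrow> 'g \<Rightarrow> 'g) \<Rightarrow> 'g set \<Rightarrow> 'g set \<Rightarrow>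
   (complex \<Rightarrow> 'v::ab_group_add \<Rightarrow> 'v) \<Rightarrow> ('g \<Rightarrow> 'v \<Rightarrow> 'v) \<Rightarrow> ('g \<Rightarrow> complex) \<Rightarrow> bool" where
  "has_highest_weight s br H B sV \<rho> \<phi> \<longleftrightarrow>
     (\<exists>v. v \<noteq> 0 \<and> v \<in> weight_space sV \<rho> H \<phi> \<and>
        (\<forall>\<beta>. positive_root s br H B \<beta> \<longrightarrow> (\<forall>x \<in> root_space s br H \<beta>. \<rho> x v = 0)))"

definition weight_mult ::
  "(complex \<Rightarrow> 'v::ab_group_add \<Rightarrow> 'v) \<Rightarrow> ('g \<Rightarrow> 'v \<Rightarrow> 'v) \<Rightarrow> 'g set \<Rightarrow> ('g \<Rightarrow> complex) \<Rightarrow> nat" where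
  "weight_mult sV \<rho> H \<phi> = vector_space.dim sV (weight_space sV \<rho> H \<phi>)"


section \<open>Symmetric powers\<close>

text \<open>
  The \<open>N\<close>-th symmetric power of \<open>V\<close> is the quotient of the free vector space on
  \<open>N\<close>-tuples of vectors by the span of the multilinearity and symmetry relations. A tuple
  \<open>[v\<^sub>1, \<dots>, v\<^sub>N]\<close> represents the symmetric product
  \<open>v\<^sub>1 \<cdots> v\<^sub>N\<close>.
\<close>

definition free_scale :: "complex \<Rightarrow> ('b \<Rightarrow>\<^sub>0 complex) \<Rightarrow> ('b \<Rightarrow>\<^sub>0 complex)" where
  "free_scale c = Poly_Mapping.map ((*) c)"

lemma vector_space_free_scale: "vector_space free_scale"
  by unfold_locales
    (auto intro!: poly_mapping_eqI
      simp: free_scale_def lookup_add Poly_Mapping.map.rep_eq when_def distrib_left[symmetric] distrib_right mult.assoc)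

definition free_tuples :: "nat \<Rightarrow> ('v list \<Rightarrow>\<^sub>0 complex) set" where
  "free_tuples N = {w. \<forall>vs \<in> Poly_Mapping.keys w. length vs = N}"

definition sym_relations ::
  "(complex \<Rightarrow> 'v::ab_group_add \<Rightarrow> 'v) \<Rightarrow> nat \<Rightarrow> ('v list \<Rightarrow>\<^sub>0 complex) set" where
  "sym_relations sV N = module.span free_scale
     ({Poly_Mapping.single (xs @ (u + v) # ys) 1 - Poly_Mapping.single (xs @ u # ys) 1
         - Poly_Mapping.single (xs @ v # ys) 1 | xs u v ys. length xs + length ys + 1 = N} \<union>
      {Poly_Mapping.single (xs @ sV c v # ys) 1 - Poly_Mapping.single (xs @ v # ys) c
         | xs c v ys. length xs + length ys + 1 = N} \<union>
      {Poly_Mapping.single xs 1 - Poly_Mapping.single ys 1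
         | xs ys. length xs = N \<and> mset xs = mset ys})"

text \<open>The linear extension of
  \<open>v\<^sub>1 \<cdots> v\<^sub>N \<mapsto> \<Sum>\<^sub>i v\<^sub>1 \<cdots> T v\<^sub>i \<cdots> v\<^sub>N\<close>.\<close>

definition sym_action :: "('v \<Rightarrow> 'v) \<Rightarrow> ('v list \<Rightarrow>\<^sub>0 complex) \<Rightarrow> ('v list \<Rightarrow>\<^sub>0 complex)" where
  "sym_action T w = (\<Sum>vs \<in> Poly_Mapping.keys w. \<Sum>i<length vs.
     Poly_Mapping.single (vs[i := T (vs ! i)]) (Poly_Mapping.lookup w vs))"

text \<open>The preimage, in the free space, of a weight space of the symmetric power.\<close>

definition sym_weight_space_rep ::
  "(complex \<Rightarrow> 'v::ab_group_add \<Rightarrow> 'v) \<Rightarrow> ('g \<Rightarrow> 'v \<Rightarrow> 'v) \<Rightarrow> 'g set \<Rightarrow> nat \<Rightarrow> ('g \<Rightarrow> complex) \<Rightarrow>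
   ('v list \<Rightarrow>\<^sub>0 complex) set" where
  "sym_weight_space_rep sV \<rho> H N \<phi> =
     {w \<in> free_tuples N. \<forall>h\<in>H. sym_action (\<rho> h) w - free_scale (\<phi> h) w \<in> sym_relations sV N}"

text \<open>The dimension of \<open>U / R\<close>, for subspaces \<open>R \<subseteq> U\<close>: the classes of the
  elements of \<open>E\<close> form a basis of the quotient.\<close>

definition quotient_dim ::
  "(complex \<Rightarrow> 'a::ab_group_add \<Rightarrow> 'a) \<Rightarrow> 'a set \<Rightarrow> 'a set \<Rightarrow> nat" where
  "quotient_dim s U R = (THE n. \<exists>E. finite E \<and> card E = n \<and> E \<subseteq> U \<and>
     \<not> module.dependent s E \<and> module.span s E \<inter> R = {0} \<and> module.span s (E \<union> R) = U)"

definition sym_weight_mult ::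
  "(complex \<Rightarrow> 'v::ab_group_add \<Rightarrow> 'v) \<Rightarrow> ('g \<Rightarrow> 'v \<Rightarrow> 'v) \<Rightarrow> 'g set \<Rightarrow> nat \<Rightarrow> ('g \<Rightarrow> complex) \<Rightarrow> nat" where
  "sym_weight_mult sV \<rho> H N \<phi> =
     quotient_dim free_scale (sym_weight_space_rep sV \<rho> H N \<phi>) (sym_relations sV N)"


section \<open>Characters, partial fractions and the torus\<close>

definition qpow :: "nat \<Rightarrow> (nat \<Rightarrow> complex) \<Rightarrow> (nat \<Rightarrow> int) \<Rightarrow> complex" where
  "qpow r q c = (\<Prod>j<r. q j powi c j)"

text \<open>Sums and products over the weight lattice are taken over this support, since
  \<open>sum\<close> and \<open>prod\<close> are trivial on infinite index sets.\<close>

definition weight_support :: "nat \<Rightarrow> ((nat \<Rightarrow> int) \<Rightarrow> nat) \<Rightarrow> (nat \<Rightarrow> int) set" where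
  "weight_support r m = {\<nu> \<in> weight_lattice r. m \<nu> \<noteq> 0}"

definition character :: "nat \<Rightarrow> ((nat \<Rightarrow> int) \<Rightarrow> nat) \<Rightarrow> (nat \<Rightarrow> complex) \<Rightarrow> complex" where
  "character r m q = (\<Sum>\<nu> \<in> weight_support r m. of_nat (m \<nu>) * qpow r q \<nu>)"

text \<open>The value at \<open>q\<close> of the coefficient of \<open>1 / (1 - q\<^sup>\<nu> z)\<^sup>k\<close> in the
  partial fraction decomposition in \<open>z\<close> of
  \<open>\<Prod>\<nu>. 1 / (1 - q\<^sup>\<nu> z)\<^bsup>m \<nu>\<^esup>\<close>. It is meaningful where the
  monomials \<open>q\<^sup>\<nu>\<close>, for \<open>\<nu>\<close> in the support, are pairwise distinct, hence
  almost everywhere on the torus.\<close>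

definition pf_coeff ::
  "nat \<Rightarrow> ((nat \<Rightarrow> int) \<Rightarrow> nat) \<Rightarrow> (nat \<Rightarrow> int) \<Rightarrow> nat \<Rightarrow> (nat \<Rightarrow> complex) \<Rightarrow> complex" where
  "pf_coeff r m \<nu> k q =
     (let l = m \<nu> - k in
        (-1) ^ l / (fact l * qpow r q \<nu> ^ l) *
        (deriv ^^ l)
          (\<lambda>z. \<Prod>\<nu>' \<in> weight_support r m - {\<nu>}. 1 / (1 - qpow r q \<nu>' * z) ^ m \<nu>')
          (qpow r q (- \<nu>)))"

definition p_poly :: "nat \<Rightarrow> nat \<Rightarrow> nat" where
  "p_poly k N = (N + k - 1) choose N"

text \<open>Lebesgue measure on the torus of total mass \<open>(2\<pi>)\<^sup>r\<close>, in the coordinates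
  \<open>x = \<Sum>\<^sub>j x\<^sub>j \<alpha>\<^sub>j\<^sup>\<or>\<close> on the fundamental domain
  \<open>0 \<le> x\<^sub>j < 2\<pi>\<close>. The completion matters: the integrand is only specified almost
  everywhere.\<close>

definition torus_measure :: "nat \<Rightarrow> (nat \<Rightarrow> real) measure" where
  "torus_measure r = completion (Pi\<^sub>M {..<r} (\<lambda>_. restrict_space lborel {0..<2 * pi}))"

definition torus_point :: "(nat \<Rightarrow> real) \<Rightarrow> nat \<Rightarrow> complex" where
  "torus_point x j = exp (\<i> * of_real (x j))"

definition laurent_coeffs ::
  "nat \<Rightarrow> ((nat \<Rightarrow> complex) \<Rightarrow> complex) \<Rightarrow> ((nat \<Rightarrow> int) \<Rightarrow> complex) \<Rightarrow> bool" where
  "laurent_coeffs r F a \<longleftrightarrow>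
     finite {c \<in> weight_lattice r. a c \<noteq> 0} \<and>
     (\<forall>q. (\<forall>j<r. q j \<noteq> 0) \<longrightarrow>
        F q = (\<Sum>c \<in> {c \<in> weight_lattice r. a c \<noteq> 0}. a c * qpow r q c))"

definition constant_term :: "nat \<Rightarrow> ((nat \<Rightarrow> complex) \<Rightarrow> complex) \<Rightarrow> complex" where
  "constant_term r F = (THE t. \<exists>a. laurent_coeffs r F a \<and> t = a (\<lambda>_. 0))"

end

theory Submission
  imports Defs "HOL-Complex_Analysis.Complex_Analysis"
begin

text \<open>
  Fix a basis of \<open>V(\<lambda>)\<close> consisting of weight vectors, and write \<open>wt b\<close> for the
  weight of the basis vector \<open>b\<close>. Everything rests on computing one Laurent polynomial in
  \<open>q\<close>, the complete homogeneous symmetric polynomial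
  \<open>h\<^sub>N\<close> of the monomials \<open>q\<^bsup>wt b\<^esup>\<close>, in three ways.

  Representation theory: the degree \<open>N\<close> monomials in the basis vectors form a basis of
  \<open>S\<^sup>N V(\<lambda>)\<close>, and each of them is a weight vector whose weight is the sum of the
  weights of its factors (\<open>sym_weight_mult_eq_card\<close>). Hence \<open>h\<^sub>N\<close> is the character of
  \<open>S\<^sup>N V(\<lambda>)\<close>.

  Generating functions: \<open>h\<^sub>N\<close> is the coefficient of \<open>z\<^sup>N\<close> in
  \<open>\<Prod>\<^sub>b 1 / (1 - q\<^bsup>wt b\<^esup> z)\<close> (\<open>fps_nth_prod_geometric\<close>). If the monomials
  \<open>q\<^sup>\<nu>\<close> are pairwise distinct, the partial fraction decomposition of this product and
  the expansion of \<open>1 / (1 - a z)\<^sup>k\<close> turn that coefficient into the double sum over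
  \<open>\<nu>\<close> and \<open>k\<close> (\<open>partial_fraction_power_series_coeff\<close>).

  Fourier analysis: integration over the torus sends \<open>q\<^sup>c\<close> to \<open>(2\<pi>)\<^sup>r\<close> if
  \<open>c = 0\<close> and to \<open>0\<close> otherwise, so it extracts constant terms
  (\<open>torus_integral_laurent_coeffs\<close>); the same fact shows that the constant term is well
  defined. Distinct monomials agree only on a null set of the torus
  (\<open>AE_torus_monomials_distinct\<close>), so the integrand equals
  \<open>q\<^bsup>-\<mu>\<^esup> h\<^sub>N\<close> almost everywhere.

  Lie theory enters through \<open>weight_basis_exists\<close>: a weight basis exists because the
  Cartan subalgebra acts on the Lie algebra by diagonalizable operators and the representation is
  irreducible, and the weights are integral combinations of the fundamental weights by the
  representation theory of \<open>sl\<^sub>2\<close>.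
\<close>

section \<open>Fourier analysis on the torus\<close>

lemma circle_integral:
  fixes n :: int
  defines "C \<equiv> restrict_space lborel {0..<2 * pi}"
  shows "integrable C (\<lambda>x. exp (\<i> * of_real x) powi n)"
    and "(LINT x|C. exp (\<i> * of_real x) powi n) = (if n = 0 then 2 * of_real pi else 0)"
proof -
  define F where "F = (\<lambda>x::real. if n = 0 then complex_of_real x
      else exp (of_int n * (\<i> * of_real x)) / (of_int n * \<i>))"
  have eq: "exp (\<i> * of_real x) powi n = exp (of_int n * (\<i> * of_real x))" for x :: real
    by (simp add: exp_power_int)
  have deriv: "(F has_vector_derivative exp (of_int n * (\<i> * of_real x))) (at x within A)" for x A
  proof (cases "n = 0")
    case True
    then show ?thesis
      unfolding F_def by (auto intro!: derivative_eq_intros)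
  next
    case False
    have "((\<lambda>z. exp (of_int n * (\<i> * z)) / (of_int n * \<i>)) has_field_derivative
        exp (of_int n * (\<i> * of_real x))) (at (of_real x))"
      using False by (auto intro!: derivative_eq_intros simp: field_simps)
    then have "((\<lambda>x. exp (of_int n * (\<i> * of_real x)) / (of_int n * \<i>)) has_vector_derivative
        exp (of_int n * (\<i> * of_real x))) (at x within A)"
      by (rule has_vector_derivative_real_field)
    then show ?thesis using False by (simp add: F_def)
  qed
  have cont: "continuous_on {0..2*pi} (\<lambda>x. exp (of_int n * (\<i> * of_real x)))"
    by (intro continuous_intros)
  have bi: "has_bochner_integral lborel
      (\<lambda>x. indicator {0..2*pi} x *\<^sub>R exp (of_int n * (\<i> * of_real x))) (F (2*pi) - F 0)"
    by (rule has_bochner_integral_FTC_Icc[OF _ deriv cont]) simp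
  \<comment> \<open>The fundamental domain is half-open; it differs from the closed interval by a null set.\<close>
  have ae: "AE x in lborel. indicator {0..2*pi} x *\<^sub>R exp (of_int n * (\<i> * of_real x)) =
      indicator {0..<2*pi} x *\<^sub>R exp (of_int n * (\<i> * of_real x))"
    using AE_lborel_singleton[of "2*pi"] by eventually_elim (auto simp: indicator_def)
  have "has_bochner_integral lborel
      (\<lambda>x. indicator {0..<2*pi} x *\<^sub>R exp (of_int n * (\<i> * of_real x))) (F (2*pi) - F 0)"
    using bi by (rule has_bochner_integral_cong_AE[THEN iffD1, rotated 3]) (use ae in auto)
  then have "has_bochner_integral C (\<lambda>x. exp (\<i> * of_real x) powi n) (F (2*pi) - F 0)"
    by (simp add: C_def has_bochner_integral_iff integrable_restrict_space integral_restrict_space eq)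
  moreover have "F (2*pi) - F 0 = (if n = 0 then 2 * of_real pi else 0)"
  proof -
    have "exp (of_int n * (\<i> * of_real (2*pi))) = 1"
      using exp_integer_2pi[of "of_int n"] by (simp add: mult_ac)
    then show ?thesis by (simp add: F_def)
  qed
  ultimately show "integrable C (\<lambda>x. exp (\<i> * of_real x) powi n)"
    and "(LINT x|C. exp (\<i> * of_real x) powi n) = (if n = 0 then 2 * of_real pi else 0)"
    by (auto simp: has_bochner_integral_iff)
qed

abbreviation torus_borel :: "nat \<Rightarrow> (nat \<Rightarrow> real) measure" where
  "torus_borel r \<equiv> Pi\<^sub>M {..<r} (\<lambda>_. restrict_space lborel {0..<2 * pi})"

lemma
  shows integrable_torus_monomial: "integrable (torus_borel r) (\<lambda>x. qpow r (torus_point x) c)"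
    and integral_torus_monomial: "(LINT x|torus_borel r. qpow r (torus_point x) c) =
      (if \<forall>j<r. c j = 0 then (2 * of_real pi) ^ r else 0)"
proof -
  interpret C: finite_measure "restrict_space lborel {0..<2 * pi}"
    by (rule finite_measureI) (simp add: emeasure_restrict_space space_restrict_space)
  interpret product_sigma_finite "\<lambda>_::nat. restrict_space lborel {0..<2 * pi}"
    by unfold_locales
  show "integrable (torus_borel r) (\<lambda>x. qpow r (torus_point x) c)"
    unfolding qpow_def torus_point_def
    by (rule product_integrable_prod) (auto intro: circle_integral)
  have "(LINT x|torus_borel r. qpow r (torus_point x) c) = (\<Prod>j<r. if c j = 0 then 2 * of_real pi else 0)"
    unfolding qpow_def torus_point_def
    by (subst product_integral_prod) (auto intro: circle_integral simp: circle_integral)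
  also have "\<dots> = (if \<forall>j<r. c j = 0 then (2 * of_real pi) ^ r else 0)"
    by auto
  finally show "(LINT x|torus_borel r. qpow r (torus_point x) c) =
      (if \<forall>j<r. c j = 0 then (2 * of_real pi) ^ r else 0)" .
qed

lemma qpow_diff:
  assumes "\<And>j. j < r \<Longrightarrow> q j \<noteq> 0"
  shows "qpow r q (\<lambda>j. c j - d j) = qpow r q c / qpow r q d"
  using assms by (simp add: qpow_def power_int_diff prod_dividef)

lemma qpow_uminus: "qpow r q (- c) = inverse (qpow r q c)"
  by (simp add: qpow_def power_int_minus prod_inversef[symmetric] o_def)

lemma torus_point_nonzero: "torus_point x j \<noteq> 0"
  by (simp add: torus_point_def)

lemma qpow_nonzero: "(\<And>j. j < r \<Longrightarrow> q j \<noteq> 0) \<Longrightarrow> qpow r q c \<noteq> 0"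
  by (auto simp: qpow_def)

lemma prod_power_int: "(\<Prod>i\<in>A. f i :: complex) powi n = (\<Prod>i\<in>A. f i powi n)"
  by (induction A rule: infinite_finite_induct) (auto simp: power_int_mult_distrib)

text \<open>
  Write \<open>u = q\<^sup>e\<close>. Where \<open>u = 1\<close>, the function
  \<open>\<bar>1 + u + \<dots> + u\<^bsup>n-1\<^esup>\<bar>\<^sup>2\<close> equals \<open>n\<^sup>2\<close>, whereas its integral is only
  \<open>n (2\<pi>)\<^sup>r\<close>, because the powers of \<open>u\<close> are orthogonal. So the set
  \<open>u = 1\<close> has measure at most \<open>(2\<pi>)\<^sup>r / n\<close> for every \<open>n\<close>.
\<close>

lemma AE_torus_monomial_neq_1:
  assumes "j < r" "e j \<noteq> 0"
  shows "AE x in torus_borel r. qpow r (torus_point x) e \<noteq> 1"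
proof -
  let ?u = "\<lambda>x. qpow r (torus_point x) e"
  define Z where "Z = {x \<in> space (torus_borel r). ?u x = 1}"
  interpret finite_measure "torus_borel r"
  proof
    show "emeasure (torus_borel r) (space (torus_borel r)) \<noteq> \<infinity>"
      using integrable_torus_monomial[of r "\<lambda>_. 0"] by (simp add: qpow_def integrable_iff_bounded less_top)
  qed
  have meas [measurable]: "?u \<in> borel_measurable (torus_borel r)"
    by (rule borel_measurable_integrable[OF integrable_torus_monomial])
  have Z [measurable]: "Z \<in> sets (torus_borel r)" unfolding Z_def by measurable
  have bound: "real n * measure (torus_borel r) Z \<le> (2 * pi) ^ r" if n: "n > 0" for n
  proof -
    let ?S = "\<lambda>x. \<Sum>k<n. ?u x ^ k"
    have mono: "?u x ^ k * cnj (?u x ^ l) = qpow r (torus_point x) (\<lambda>i. (int k - int l) * e i)" for x k l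
    proof -
      have "cnj (torus_point x i powi e i) = inverse (torus_point x i powi e i)" for i
        by (simp add: torus_point_def exp_power_int exp_cnj flip: exp_minus)
      then have "cnj (?u x) = inverse (?u x)"
        by (simp add: qpow_def prod_inversef[symmetric] o_def)
      then have "?u x ^ k * cnj (?u x ^ l) = ?u x ^ k * inverse (?u x) ^ l"
        by (simp only: complex_cnj_power)
      also have "\<dots> = ?u x powi (int k - int l)"
        using qpow_nonzero[of r "torus_point x" e]
        by (simp add: torus_point_nonzero power_int_diff field_simps)
      also have "\<dots> = qpow r (torus_point x) (\<lambda>i. (int k - int l) * e i)"
        by (simp add: qpow_def prod_power_int mult.commute[of "int k - int l"] power_int_mult)
      finally show ?thesis .
    qed
    have sq: "complex_of_real ((cmod (?S x))\<^sup>2) =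
        (\<Sum>k<n. \<Sum>l<n. qpow r (torus_point x) (\<lambda>i. (int k - int l) * e i))" for x
      unfolding complex_norm_square by (simp add: sum_product flip: mono)
    have int: "integrable (torus_borel r) (\<lambda>x. complex_of_real ((cmod (?S x))\<^sup>2))"
      unfolding sq by (intro Bochner_Integration.integrable_sum integrable_torus_monomial)
    have "complex_of_real (LINT x|torus_borel r. (cmod (?S x))\<^sup>2) =
        (LINT x|torus_borel r. complex_of_real ((cmod (?S x))\<^sup>2))"
      by (rule integral_complex_of_real[symmetric])
    also have "\<dots> = (\<Sum>k<n. \<Sum>l<n. LINT x|torus_borel r. qpow r (torus_point x) (\<lambda>i. (int k - int l) * e i))"
      unfolding sq by (simp add: integrable_torus_monomial)
    also have "\<dots> = (\<Sum>k<n. \<Sum>l<n. if l = k then (2 * of_real pi) ^ r else 0)"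
      unfolding integral_torus_monomial using assms by (intro sum.cong refl) auto
    also have "\<dots> = of_real (real n * (2 * pi) ^ r)" by simp
    finally have val: "(LINT x|torus_borel r. (cmod (?S x))\<^sup>2) = real n * (2 * pi) ^ r"
      by (simp only: of_real_eq_iff)
    have "(real n)\<^sup>2 * measure (torus_borel r) Z = (LINT x|torus_borel r. (real n)\<^sup>2 * indicator Z x)"
      by simp
    also have "\<dots> \<le> (LINT x|torus_borel r. (cmod (?S x))\<^sup>2)"
    proof (rule integral_mono)
      show "integrable (torus_borel r) (\<lambda>x. (real n)\<^sup>2 * indicator Z x)"
        by (intro integrable_mult_right) (simp add: less_top[symmetric])
      show "integrable (torus_borel r) (\<lambda>x. (cmod (?S x))\<^sup>2)"
        using int by (simp only: complex_of_real_integrable_eq)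
      show "(real n)\<^sup>2 * indicator Z x \<le> (cmod (?S x))\<^sup>2" for x
        by (auto simp: indicator_def Z_def)
    qed
    also note val
    finally show ?thesis using n by (simp add: power2_eq_square)
  qed
  have "measure (torus_borel r) Z = 0"
  proof (rule ccontr)
    assume "measure (torus_borel r) Z \<noteq> 0"
    then have pos: "measure (torus_borel r) Z > 0" by (simp add: zero_less_measure_iff)
    then obtain n :: nat where n: "(2 * pi) ^ r < real n * measure (torus_borel r) Z"
      using reals_Archimedean3 by blast
    moreover have "0 \<le> (2 * pi) ^ r" by simp
    ultimately have "n > 0" by (metis gr0I leD mult_zero_left of_nat_0)
    moreover note n
    ultimately show False using bound[of n] by linarith
  qed
  then have "Z \<in> null_sets (torus_borel r)" by (simp add: null_setsI emeasure_eq_measure)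
  then show ?thesis by (rule AE_I') (auto simp: Z_def)
qed

lemma AE_torus_monomials_distinct:
  assumes "finite S" "S \<subseteq> weight_lattice r"
  shows "AE x in torus_borel r. inj_on (qpow r (torus_point x)) S"
proof -
  have "AE x in torus_borel r. \<forall>c\<in>S. \<forall>d\<in>S. c \<noteq> d \<longrightarrow> qpow r (torus_point x) c \<noteq> qpow r (torus_point x) d"
  proof (intro AE_finite_allI assms(1))
    fix c d assume cd: "c \<in> S" "d \<in> S"
    show "AE x in torus_borel r. c \<noteq> d \<longrightarrow> qpow r (torus_point x) c \<noteq> qpow r (torus_point x) d"
    proof (cases "c = d")
      case False
      then obtain j where j: "c j \<noteq> d j" by auto
      with cd assms(2) have "j < r" unfolding weight_lattice_def
        by (metis (mono_tags, lifting) mem_Collect_eq not_less subsetD)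
      then have "AE x in torus_borel r. qpow r (torus_point x) (\<lambda>j. c j - d j) \<noteq> 1"
        using j by (intro AE_torus_monomial_neq_1[of j]) auto
      then show ?thesis
        by (rule eventually_mono)
          (use qpow_nonzero[of r] torus_point_nonzero in \<open>auto simp: qpow_diff\<close>)
    qed simp
  qed
  then show ?thesis by (rule eventually_mono) (auto simp: inj_on_def)
qed

lemma torus_integral_laurent:
  assumes "finite S" "S \<subseteq> weight_lattice r"
  shows "integrable (torus_borel r) (\<lambda>x. \<Sum>c\<in>S. a c * qpow r (torus_point x) c)"
    and "(LINT x|torus_borel r. (\<Sum>c\<in>S. a c * qpow r (torus_point x) c)) =
      (2 * of_real pi) ^ r * (if (\<lambda>_. 0) \<in> S then a (\<lambda>_. 0) else 0)"
proof -
  show "integrable (torus_borel r) (\<lambda>x. \<Sum>c\<in>S. a c * qpow r (torus_point x) c)"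
    by (intro Bochner_Integration.integrable_sum integrable_mult_right integrable_torus_monomial)
  have "(LINT x|torus_borel r. (\<Sum>c\<in>S. a c * qpow r (torus_point x) c)) =
      (\<Sum>c\<in>S. a c * (if \<forall>j<r. c j = 0 then (2 * of_real pi) ^ r else 0))"
    by (subst Bochner_Integration.integral_sum)
      (auto simp: integral_torus_monomial intro: integrable_torus_monomial)
  also have "\<dots> = (\<Sum>c\<in>S. if c = (\<lambda>_. 0) then (2 * of_real pi) ^ r * a (\<lambda>_. 0) else 0)"
  proof (intro sum.cong refl)
    fix c assume "c \<in> S"
    then have "(\<forall>j<r. c j = 0) \<longleftrightarrow> c = (\<lambda>_. 0)"
      using assms(2) by (auto simp: weight_lattice_def fun_eq_iff subset_iff) (metis not_less)
    then show "a c * (if \<forall>j<r. c j = 0 then (2 * of_real pi) ^ r else 0) =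
        (if c = (\<lambda>_. 0) then (2 * of_real pi) ^ r * a (\<lambda>_. 0) else 0)" by simp
  qed
  also have "\<dots> = (2 * of_real pi) ^ r * (if (\<lambda>_. 0) \<in> S then a (\<lambda>_. 0) else 0)"
    using assms(1) by simp
  finally show "(LINT x|torus_borel r. (\<Sum>c\<in>S. a c * qpow r (torus_point x) c)) =
      (2 * of_real pi) ^ r * (if (\<lambda>_. 0) \<in> S then a (\<lambda>_. 0) else 0)" .
qed

lemma torus_integral_laurent_coeffs:
  assumes "laurent_coeffs r F a"
  shows "integrable (torus_borel r) (\<lambda>x. F (torus_point x))"
    and "(LINT x|torus_borel r. F (torus_point x)) = (2 * of_real pi) ^ r * a (\<lambda>_. 0)"
proof -
  let ?S = "{c \<in> weight_lattice r. a c \<noteq> 0}"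
  have fin: "finite ?S" and F: "F (torus_point x) = (\<Sum>c\<in>?S. a c * qpow r (torus_point x) c)" for x
    using assms torus_point_nonzero unfolding laurent_coeffs_def by auto
  have S: "?S \<subseteq> weight_lattice r" by auto
  show "integrable (torus_borel r) (\<lambda>x. F (torus_point x))"
    unfolding F by (rule torus_integral_laurent[OF fin S])
  have "(\<lambda>_. 0) \<in> weight_lattice r" by (simp add: weight_lattice_def)
  then show "(LINT x|torus_borel r. F (torus_point x)) = (2 * of_real pi) ^ r * a (\<lambda>_. 0)"
    unfolding F torus_integral_laurent[OF fin S] by simp
qed

text \<open>
  The coefficients of a Laurent polynomial are determined by its values, since the integral over
  the torus recovers the constant one.
\<close>

lemma constant_term_eqI:
  assumes "laurent_coeffs r F a"
  shows "constant_term r F = a (\<lambda>_. 0)"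
  unfolding constant_term_def
proof (rule the_equality)
  fix t assume "\<exists>a. laurent_coeffs r F a \<and> t = a (\<lambda>_. 0)"
  then obtain a' where "laurent_coeffs r F a'" "t = a' (\<lambda>_. 0)" by blast
  then have "(2 * complex_of_real pi) ^ r * t = (2 * of_real pi) ^ r * a (\<lambda>_. 0)"
    using torus_integral_laurent_coeffs(2) assms by metis
  then show "t = a (\<lambda>_. 0)" by simp
qed (use assms in blast)

text \<open>
  The function \<open>f\<close> may be arbitrary on the exceptional null set, because all subsets of that set
  are measurable in the completion.
\<close>

lemma borel_measurable_completion_AE:
  fixes f g :: "'a \<Rightarrow> 'b::topological_space"
  assumes g: "g \<in> borel_measurable M" and ae: "AE x in M. f x = g x"
  shows "f \<in> borel_measurable (completion M)"
proof (rule measurableI)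
  fix A :: "'b set" assume A: "A \<in> sets borel"
  from ae obtain N where N: "N \<in> null_sets M" "{x \<in> space M. f x \<noteq> g x} \<subseteq> N"
    unfolding eventually_ae_filter by auto
  have "g -` A \<inter> space M - N \<in> sets M" using g A N by (auto dest: measurable_sets)
  moreover have "f -` A \<inter> space M = (g -` A \<inter> space M - N) \<union> (f -` A \<inter> space M \<inter> N)"
    using N(2) by auto
  ultimately show "f -` A \<inter> space (completion M) \<in> sets (completion M)"
    unfolding space_completion by (intro sets_completionI[OF _ _ N(1)]) auto
qed simp

lemma torus_integral_AE:
  assumes "laurent_coeffs r F a" and ae: "AE x in torus_borel r. f x = F (torus_point x)"
  shows "integrable (torus_measure r) f"
    and "(LINT x|torus_measure r. f x) = (2 * of_real pi) ^ r * a (\<lambda>_. 0)"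
proof -
  note F = torus_integral_laurent_coeffs[OF assms(1)]
  have mF: "(\<lambda>x. F (torus_point x)) \<in> borel_measurable (torus_borel r)"
    using F(1) by (rule borel_measurable_integrable)
  have mf: "f \<in> borel_measurable (torus_measure r)"
    unfolding torus_measure_def by (rule borel_measurable_completion_AE[OF mF ae])
  have ae': "AE x in torus_measure r. f x = F (torus_point x)"
    unfolding torus_measure_def by (rule AE_completion[OF ae])
  have mF': "(\<lambda>x. F (torus_point x)) \<in> borel_measurable (torus_measure r)"
    unfolding torus_measure_def by (rule measurable_completion[OF mF])
  show "integrable (torus_measure r) f"
    using F(1) integrable_cong_AE[OF mf mF' ae'] integrable_completion[OF mF]
    by (simp add: torus_measure_def)
  show "(LINT x|torus_measure r. f x) = (2 * of_real pi) ^ r * a (\<lambda>_. 0)"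
    using F(2) integral_cong_AE[OF mf mF' ae'] integral_completion[OF mF]
    by (simp add: torus_measure_def)
qed

section \<open>Partial fractions and complete homogeneous symmetric polynomials\<close>

definition geometric_fps :: "complex \<Rightarrow> complex fps" where
  "geometric_fps a = Abs_fps (\<lambda>n. a ^ n)"

text \<open>
  The bridge between rational functions of \<open>z\<close>, in which partial fractions are computed, and
  formal power series, whose coefficients are compared.
\<close>

lemma has_fps_expansion_geometric: "(\<lambda>z. 1 / (1 - a * z)) has_fps_expansion geometric_fps a"
proof -
  have "(\<lambda>z. inverse (1 - a * z)) has_fps_expansion inverse (1 - fps_const a * fps_X)"
    by (intro fps_expansion_intros) auto
  also have "inverse (1 - fps_const a * fps_X) = geometric_fps a"
  proof (rule fps_inverse_unique)
    show "(1 - fps_const a * fps_X) * geometric_fps a = 1"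
    proof (rule fps_ext)
      show "fps_nth ((1 - fps_const a * fps_X) * geometric_fps a) n = fps_nth 1 n" for n
        by (cases n) (simp_all add: left_diff_distrib mult.assoc geometric_fps_def)
    qed
  qed
  finally show ?thesis by (simp add: field_simps)
qed

lemma fps_nth_geometric_power:
  assumes "k \<ge> 1"
  shows "fps_nth (geometric_fps a ^ k) n = of_nat (p_poly k n) * a ^ n"
  using assms
proof (induction k arbitrary: n rule: dec_induct)
  case base
  show ?case by (simp add: geometric_fps_def p_poly_def)
next
  case (step k)
  have "fps_nth (geometric_fps a ^ Suc k) n =
      (\<Sum>i\<le>n. fps_nth (geometric_fps a ^ k) i * fps_nth (geometric_fps a) (n - i))"
    by (simp only: power_Suc2 fps_mult_nth atLeast0AtMost)
  also have "\<dots> = (\<Sum>i\<le>n. of_nat (p_poly k i) * a ^ n)"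
    unfolding step.IH unfolding geometric_fps_def
    by (intro sum.cong refl) (simp add: mult.assoc flip: power_add)
  also have "\<dots> = of_nat (\<Sum>i\<le>n. (k - 1 + i) choose i) * a ^ n"
    using step.hyps by (simp add: p_poly_def sum_distrib_right add.commute)
  also have "(\<Sum>i\<le>n. (k - 1 + i) choose i) = p_poly (Suc k) n"
    using step.hyps sum_choose_lower[of "k - 1" n] by (simp add: p_poly_def add.commute)
  finally show ?case .
qed

definition complete_homogeneous :: "('b \<Rightarrow> complex) \<Rightarrow> 'b set \<Rightarrow> nat \<Rightarrow> complex" where
  "complete_homogeneous a E N = (\<Sum>M | set_mset M \<subseteq> E \<and> size M = N. \<Prod>b\<in>#M. a b)"

lemma finite_multisets_of_size: "finite E \<Longrightarrow> finite {M. set_mset M \<subseteq> E \<and> size M = N}"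
proof -
  assume "finite E"
  have "{M. set_mset M \<subseteq> E \<and> size M = N} \<subseteq> mset ` {vs. set vs \<subseteq> E \<and> length vs = N}"
  proof clarify
    fix M assume "set_mset M \<subseteq> E" "N = size M"
    moreover obtain vs where "mset vs = M" using ex_mset by blast
    ultimately show "M \<in> mset ` {vs. set vs \<subseteq> E \<and> length vs = size M}" by auto
  qed
  then show ?thesis
    by (rule finite_subset) (intro finite_imageI finite_lists_length_eq \<open>finite E\<close>)
qed

text \<open>
  A multiset on \<open>insert e E\<close> is determined by the multiplicity of \<open>e\<close> and by the
  multiset of its remaining elements. The right-hand side is a Cauchy product, as needed for
  multiplying by one more geometric series.
\<close>

lemma complete_homogeneous_insert:
  assumes "finite E" "e \<notin> E"
  shows "complete_homogeneous a (insert e E) N = (\<Sum>i\<le>N. a e ^ i * complete_homogeneous a E (N - i))"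
proof -
  let ?M = "\<lambda>n. {M. set_mset M \<subseteq> E \<and> size M = n}"
  have "(\<Sum>i\<le>N. a e ^ i * complete_homogeneous a E (N - i)) =
      (\<Sum>(i, M)\<in>Sigma {..N} (\<lambda>i. ?M (N - i)). a e ^ i * (\<Prod>b\<in>#M. a b))"
    using finite_multisets_of_size[OF assms(1)]
    by (simp add: complete_homogeneous_def sum_distrib_left sum.Sigma)
  also have "\<dots> = complete_homogeneous a (insert e E) N"
    unfolding complete_homogeneous_def
  proof (rule sum.reindex_bij_witness[where
        i = "\<lambda>M. (count M e, filter_mset (\<lambda>b. b \<noteq> e) M)" and j = "\<lambda>(i, M). replicate_mset i e + M"])
    fix x assume x: "x \<in> Sigma {..N} (\<lambda>i. ?M (N - i))"
    then have ne: "e \<notin># snd x" using assms(2) by auto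
    then have "filter_mset (\<lambda>b. b \<noteq> e) (snd x) = snd x"
      by (auto intro!: filter_mset_eq_conv[THEN iffD2])
    with ne show "(count (case x of (i, M) \<Rightarrow> replicate_mset i e + M) e,
        filter_mset (\<lambda>b. b \<noteq> e) (case x of (i, M) \<Rightarrow> replicate_mset i e + M)) = x"
      by (cases x) (auto simp: not_in_iff)
    show "(case x of (i, M) \<Rightarrow> replicate_mset i e + M) \<in> {M. set_mset M \<subseteq> insert e E \<and> size M = N}"
      using x by (auto split: if_splits)
    show "(\<Prod>b\<in>#(case x of (i, M) \<Rightarrow> replicate_mset i e + M). a b) = (case x of (i, M) \<Rightarrow> a e ^ i * (\<Prod>b\<in>#M. a b))"
      by (cases x) simp
  next
    fix M assume M: "M \<in> {M. set_mset M \<subseteq> insert e E \<and> size M = N}"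
    have part: "replicate_mset (count M e) e + filter_mset (\<lambda>b. b \<noteq> e) M = M"
      by (rule multiset_eqI) auto
    then show "(case (count M e, filter_mset (\<lambda>b. b \<noteq> e) M) of (i, M) \<Rightarrow> replicate_mset i e + M) = M"
      by simp
    have "count M e + size (filter_mset (\<lambda>b. b \<noteq> e) M) = N"
      using arg_cong[OF part, of size] M by simp
    then show "(count M e, filter_mset (\<lambda>b. b \<noteq> e) M) \<in> Sigma {..N} (\<lambda>i. ?M (N - i))"
      using M by auto
  qed
  finally show ?thesis by simp
qed

lemma fps_nth_prod_geometric:
  assumes "finite E"
  shows "fps_nth (\<Prod>b\<in>E. geometric_fps (a b)) N = complete_homogeneous a E N"
  using assms
proof (induction E arbitrary: N)
  case empty
  have "{M. M = {#} \<and> size M = N} = (if N = 0 then {{#}} else {})" by auto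
  then show ?case by (simp add: complete_homogeneous_def)
next
  case (insert e E)
  then show ?case
    by (simp add: complete_homogeneous_insert fps_mult_nth geometric_fps_def atLeast0AtMost)
qed

context
  fixes I :: "'i set" and a :: "'i \<Rightarrow> complex"
  assumes fin: "finite I" and inj: "inj_on a I"
begin

text \<open>
  Functions which, away from the poles, are combinations of \<open>1 / (1 - a\<^sub>i z)\<^sup>k\<close> with
  \<open>1 \<le> k \<le> m\<^sub>i\<close>. The coefficients \<open>B\<close> must not depend on \<open>z\<close>; this is what
  allows them to be read off from expansions at different points.
\<close>

definition partial_fraction :: "('i \<Rightarrow> nat) \<Rightarrow> (complex \<Rightarrow> complex) \<Rightarrow> bool" where
  "partial_fraction m f \<longleftrightarrow> (\<exists>B. \<forall>z. (\<forall>i\<in>I. a i * z \<noteq> 1) \<longrightarrow>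
     f z = (\<Sum>i\<in>I. \<Sum>k=1..m i. B i k * (1 / (1 - a i * z)) ^ k))"

lemma partial_fraction_cong:
  assumes "\<And>z. \<forall>i\<in>I. a i * z \<noteq> 1 \<Longrightarrow> f z = g z"
  shows "partial_fraction m f \<longleftrightarrow> partial_fraction m g"
  unfolding partial_fraction_def using assms by auto

lemma partial_fraction_add:
  assumes "partial_fraction m f" "partial_fraction m g"
  shows "partial_fraction m (\<lambda>z. f z + g z)"
proof -
  from assms(1) obtain B where
    B: "\<And>z. \<forall>i\<in>I. a i * z \<noteq> 1 \<Longrightarrow> f z = (\<Sum>i\<in>I. \<Sum>k=1..m i. B i k * (1 / (1 - a i * z)) ^ k)"
    unfolding partial_fraction_def by blast
  from assms(2) obtain C where
    C: "\<And>z. \<forall>i\<in>I. a i * z \<noteq> 1 \<Longrightarrow> g z = (\<Sum>i\<in>I. \<Sum>k=1..m i. C i k * (1 / (1 - a i * z)) ^ k)"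
    unfolding partial_fraction_def by blast
  then show ?thesis unfolding partial_fraction_def
    by (intro exI[of _ "\<lambda>i k. B i k + C i k"]) (simp add: B C distrib_right sum.distrib)
qed

lemma partial_fraction_scale:
  assumes "partial_fraction m f"
  shows "partial_fraction m (\<lambda>z. c * f z)"
proof -
  from assms obtain B where
    B: "\<And>z. \<forall>i\<in>I. a i * z \<noteq> 1 \<Longrightarrow> f z = (\<Sum>i\<in>I. \<Sum>k=1..m i. B i k * (1 / (1 - a i * z)) ^ k)"
    unfolding partial_fraction_def by blast
  then show ?thesis unfolding partial_fraction_def
    by (intro exI[of _ "\<lambda>i k. c * B i k"]) (simp add: B sum_distrib_left mult.assoc)
qed

lemma partial_fraction_0: "partial_fraction m (\<lambda>z. 0)"
  unfolding partial_fraction_def by (intro exI[of _ "\<lambda>i k. 0"]) simp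

lemma partial_fraction_sum:
  "(\<And>x. x \<in> A \<Longrightarrow> partial_fraction m (f x)) \<Longrightarrow> partial_fraction m (\<lambda>z. \<Sum>x\<in>A. f x z)"
  by (induction A rule: infinite_finite_induct) (auto intro: partial_fraction_0 partial_fraction_add)

lemma partial_fraction_power:
  assumes "i \<in> I" "1 \<le> k" "k \<le> m i"
  shows "partial_fraction m (\<lambda>z. (1 / (1 - a i * z)) ^ k)"
  unfolding partial_fraction_def
proof (intro exI allI impI)
  fix z
  have "(\<Sum>i'\<in>I. \<Sum>k'=1..m i'. (if i' = i \<and> k' = k then 1 else 0) * (1 / (1 - a i' * z)) ^ k') =
     (\<Sum>i'\<in>{i}. \<Sum>k'=1..m i'. (if i' = i \<and> k' = k then 1 else 0) * (1 / (1 - a i' * z)) ^ k')"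
    using assms fin by (intro sum.mono_neutral_right) auto
  also have "\<dots> = (\<Sum>k'=1..m i. if k' = k then (1 / (1 - a i * z)) ^ k' else 0)"
  proof -
    have "(\<Sum>k'=1..m i. (if i = i \<and> k' = k then 1 else 0) * (1 / (1 - a i * z)) ^ k') =
        (\<Sum>k'=1..m i. if k' = k then (1 / (1 - a i * z)) ^ k' else 0)"
      by (intro sum.cong) auto
    then show ?thesis by simp
  qed
  also have "\<dots> = (1 / (1 - a i * z)) ^ k" using assms by simp
  finally show "(1 / (1 - a i * z)) ^ k =
    (\<Sum>i'\<in>I. \<Sum>k'=1..m i'. (if i' = i \<and> k' = k then 1 else 0) * (1 / (1 - a i' * z)) ^ k')" by simp
qed

text \<open>
  Induction on \<open>k\<close> from
  \<open>(a\<^sub>i - a\<^sub>j) / ((1 - a\<^sub>i z) (1 - a\<^sub>j z)) = a\<^sub>i / (1 - a\<^sub>i z) - a\<^sub>j / (1 - a\<^sub>j z)\<close>: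
  each application trades one factor with the index \<open>i\<close> for a term that is already of the
  required form.
\<close>

lemma partial_fraction_power_times:
  assumes "i \<in> I" "j \<in> I" "i \<noteq> j" "1 \<le> k" "k \<le> m i" "1 \<le> m j"
  shows "partial_fraction m (\<lambda>z. (1 / (1 - a i * z)) ^ k * (1 / (1 - a j * z)))"
  using assms(4,5)
proof (induction k rule: dec_induct)
  have ne: "a i \<noteq> a j" using inj assms by (auto dest: inj_onD)
  define c where "c = a i / (a i - a j)"
  define d where "d = - a j / (a i - a j)"
  have split: "1 / (1 - a i * z) * (1 / (1 - a j * z)) = c * (1 / (1 - a i * z)) + d * (1 / (1 - a j * z))"
    if "\<forall>i\<in>I. a i * z \<noteq> 1" for z
  proof -
    have "1 - a i * z \<noteq> 0" "1 - a j * z \<noteq> 0" "a i - a j \<noteq> 0" using that assms ne by auto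
    then show ?thesis by (simp add: c_def d_def divide_simps) (simp add: algebra_simps)
  qed
  {
    case base
    have "partial_fraction m (\<lambda>z. c * (1 / (1 - a i * z)) ^ 1 + d * (1 / (1 - a j * z)) ^ 1)"
      using assms by (intro partial_fraction_add partial_fraction_scale partial_fraction_power) auto
    then show ?case
      by (subst partial_fraction_cong) (use split in auto)
  next
    case (step k)
    have "partial_fraction m (\<lambda>z. c * (1 / (1 - a i * z)) ^ Suc k
        + d * ((1 / (1 - a i * z)) ^ k * (1 / (1 - a j * z))))"
      using assms step by (intro partial_fraction_add partial_fraction_scale partial_fraction_power) auto
    moreover have "(1 / (1 - a i * z)) ^ Suc k * (1 / (1 - a j * z)) =
        c * (1 / (1 - a i * z)) ^ Suc k + d * ((1 / (1 - a i * z)) ^ k * (1 / (1 - a j * z)))"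
      if "\<forall>i\<in>I. a i * z \<noteq> 1" for z
    proof -
      have "(1 / (1 - a i * z)) ^ Suc k * (1 / (1 - a j * z)) =
        (1 / (1 - a i * z)) ^ k * (1 / (1 - a i * z) * (1 / (1 - a j * z)))" by simp
      also have "\<dots> = (1 / (1 - a i * z)) ^ k * (c * (1 / (1 - a i * z)) + d * (1 / (1 - a j * z)))"
        by (simp only: split[OF that])
      finally show ?thesis by (simp only: power_Suc2 algebra_simps)
    qed
    ultimately show ?case by (subst partial_fraction_cong) auto
  }
qed

lemma partial_fraction_times:
  assumes "partial_fraction m f" "j \<in> I"
  shows "partial_fraction (m(j := Suc (m j))) (\<lambda>z. f z * (1 / (1 - a j * z)))"
proof -
  let ?m = "m(j := Suc (m j))"
  from assms obtain B where B:
    "\<And>z. \<forall>i\<in>I. a i * z \<noteq> 1 \<Longrightarrow> f z = (\<Sum>i\<in>I. \<Sum>k=1..m i. B i k * (1 / (1 - a i * z)) ^ k)"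
    unfolding partial_fraction_def by blast
  have "partial_fraction ?m (\<lambda>z. (1 / (1 - a i * z)) ^ k * (1 / (1 - a j * z)))"
    if "i \<in> I" "k \<in> {1..m i}" for i k
  proof (cases "i = j")
    case True
    have "partial_fraction ?m (\<lambda>z. (1 / (1 - a j * z)) ^ Suc k)"
      using that assms True by (intro partial_fraction_power) auto
    then show ?thesis using True by (simp add: mult.commute)
  next
    case False
    then show ?thesis using that assms by (intro partial_fraction_power_times) auto
  qed
  then have "partial_fraction ?m
     (\<lambda>z. \<Sum>i\<in>I. \<Sum>k=1..m i. B i k * ((1 / (1 - a i * z)) ^ k * (1 / (1 - a j * z))))"
    by (intro partial_fraction_sum partial_fraction_scale) auto
  then show ?thesis
    by (subst partial_fraction_cong) (auto simp: B sum_distrib_right sum_divide_distrib mult.assoc)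
qed

lemma partial_fraction_prod:
  assumes "\<exists>i\<in>I. m i \<noteq> 0"
  shows "partial_fraction m (\<lambda>z. \<Prod>i\<in>I. (1 / (1 - a i * z)) ^ m i)"
  using assms
proof (induction "\<Sum>i\<in>I. m i" arbitrary: m)
  case 0
  then show ?case using fin by auto
next
  case (Suc n)
  then obtain j where j: "j \<in> I" "m j \<noteq> 0" by auto
  define m' where "m' = m(j := m j - 1)"
  have m: "m = m'(j := Suc (m' j))" using j by (auto simp: m'_def)
  have prod: "(\<Prod>i\<in>I. (1 / (1 - a i * z)) ^ m i) =
      (\<Prod>i\<in>I. (1 / (1 - a i * z)) ^ m' i) * (1 / (1 - a j * z))" for z
  proof -
    have "(\<Prod>i\<in>I - {j}. (1 / (1 - a i * z)) ^ m i) = (\<Prod>i\<in>I - {j}. (1 / (1 - a i * z)) ^ m' i)"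
      by (intro prod.cong) (auto simp: m'_def)
    then show ?thesis
      using fin j by (simp add: prod.remove[of I j] m) 
  qed
  show ?case
  proof (cases "\<exists>i\<in>I. m' i \<noteq> 0")
    case True
    have "(\<Sum>i\<in>I. m i) = Suc (\<Sum>i\<in>I. m' i)"
      using fin j sum.cong[of "I - {j}" "I - {j}" m m'] by (simp add: sum.remove[of I j] m)
    then have "partial_fraction m' (\<lambda>z. \<Prod>i\<in>I. (1 / (1 - a i * z)) ^ m' i)"
      using Suc True by auto
    from partial_fraction_times[OF this j(1)] show ?thesis
      unfolding prod by (subst m) simp
  next
    case False
    then have "(\<Prod>i\<in>I. (1 / (1 - a i * z)) ^ m' i) = 1" for z by (intro prod.neutral) auto
    then show ?thesis
      unfolding prod using partial_fraction_power[of j 1 m] j by simp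
  qed
qed

text \<open>
  Multiply the decomposition by \<open>(1 - a\<^sub>j z)\<close> to the power \<open>m\<^sub>j\<close> and expand at
  \<open>z = 1 / a\<^sub>j + w\<close>, where \<open>1 - a\<^sub>j z = - a\<^sub>j w\<close>. The left-hand side becomes the product
  \<open>G\<close> over the other indices. On the right-hand side, the terms with other poles are divisible by
  \<open>w\<close> to the power \<open>m\<^sub>j\<close>, so that the coefficient of \<open>w\<^sup>l\<close> with
  \<open>l = m\<^sub>j - k\<close> consists of \<open>B j k\<close> times \<open>(- a\<^sub>j)\<^sup>l\<close> alone; on the left it is a
  Taylor coefficient of \<open>G\<close>.
\<close>

lemma partial_fraction_coeff:
  assumes nz: "\<And>i. i \<in> I \<Longrightarrow> a i \<noteq> 0"
    and B: "\<And>z. \<forall>i\<in>I. a i * z \<noteq> 1 \<Longrightarrow>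
      (\<Prod>i\<in>I. (1 / (1 - a i * z)) ^ m i) = (\<Sum>i\<in>I. \<Sum>k=1..m i. B i k * (1 / (1 - a i * z)) ^ k)"
    and j: "j \<in> I" and k: "1 \<le> k" "k \<le> m j"
  shows "B j k = (-1) ^ (m j - k) / (fact (m j - k) * a j ^ (m j - k)) *
    (deriv ^^ (m j - k)) (\<lambda>z. \<Prod>i\<in>I - {j}. 1 / (1 - a i * z) ^ m i) (1 / a j)"
proof -
  define l where "l = m j - k"
  define z0 where "z0 = 1 / a j"
  define G where "G = (\<lambda>z. \<Prod>i\<in>I - {j}. 1 / (1 - a i * z) ^ m i)"
  define K where "K = (\<lambda>z. \<Sum>i\<in>I - {j}. \<Sum>k=1..m i. B i k * (1 / (1 - a i * z)) ^ k)"
  have z0: "a i * z0 \<noteq> 1" if "i \<in> I - {j}" for i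
    using that inj nz j by (auto simp: z0_def field_simps inj_on_def)
  have anG: "G analytic_on {z0}" unfolding G_def
    using z0 by (intro analytic_intros) auto
  have anK: "K analytic_on {z0}" unfolding K_def
    using z0 by (intro analytic_intros) auto
  define GF KF where "GF = fps_expansion G z0" and "KF = fps_expansion K z0"
  have GF: "(\<lambda>w. G (z0 + w)) has_fps_expansion GF"
    unfolding GF_def by (rule analytic_at_imp_has_fps_expansion[OF anG])
  have KF: "(\<lambda>w. K (z0 + w)) has_fps_expansion KF"
    unfolding KF_def by (rule analytic_at_imp_has_fps_expansion[OF anK])
  define c where "c = - a j"
  define P where "P = (\<lambda>w. (\<Sum>k=1..m j. B j k * (c * w) ^ (m j - k)) + (c * w) ^ m j * K (z0 + w))"
  define PF where "PF = (\<Sum>k=1..m j. fps_const (B j k) * (fps_const c * fps_X) ^ (m j - k))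
    + (fps_const c * fps_X) ^ m j * KF"
  have P: "P has_fps_expansion PF"
    unfolding P_def PF_def by (intro fps_expansion_intros KF)
  have eq: "G (z0 + w) = P w" if "\<forall>i\<in>I. a i * (z0 + w) \<noteq> 1" for w
  proof -
    have cw: "1 - a j * (z0 + w) = c * w" using nz[OF j] by (simp add: z0_def c_def field_simps)
    with that j have cw0: "c * w \<noteq> 0" by (metis eq_iff_diff_eq_0)
    have "G (z0 + w) / (c * w) ^ m j = (\<Prod>i\<in>I. (1 / (1 - a i * (z0 + w))) ^ m i)"
      using fin j by (simp add: prod.remove[of I j] G_def cw power_divide)
    also have "\<dots> = (\<Sum>k=1..m j. B j k * (1 / (c * w)) ^ k) + K (z0 + w)"
      unfolding B[OF that] using fin j by (simp add: sum.remove[of I j] K_def cw)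
    finally have "G (z0 + w) = (c * w) ^ m j * ((\<Sum>k=1..m j. B j k * (1 / (c * w)) ^ k) + K (z0 + w))"
      using cw0 by (simp add: field_simps)
    also have "\<dots> = P w"
      unfolding P_def distrib_left sum_distrib_left using cw0
      by (intro arg_cong2[of _ _ _ _ "(+)"] sum.cong refl) (simp add: power_diff field_simps)
    finally show ?thesis .
  qed
  \<comment> \<open>The decomposition only speaks about \<open>w \<noteq> 0\<close>; continuity extends the identity to \<open>w = 0\<close>.\<close>
  have "eventually (\<lambda>w. \<forall>i\<in>I. a i * (z0 + w) \<noteq> 1) (at 0)"
    unfolding eventually_ball_finite_distrib[OF fin]
  proof
    fix i assume i: "i \<in> I"
    show "eventually (\<lambda>w. a i * (z0 + w) \<noteq> 1) (at 0)"
    proof (cases "i = j")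
      case True
      have "eventually (\<lambda>w::complex. w \<noteq> 0) (at 0)" by (simp add: eventually_at_filter)
      then show ?thesis
        using True nz[OF i] by (auto elim!: eventually_mono simp: z0_def field_simps)
    next
      case False
      have "((\<lambda>w. a i * (z0 + w)) \<longlongrightarrow> a i * (z0 + 0)) (at 0)" by (intro tendsto_intros)
      then show ?thesis using z0[of i] i False by (intro tendsto_imp_eventually_ne[of _ "a i * z0"]) auto
    qed
  qed
  then have ev: "eventually (\<lambda>w. G (z0 + w) = P w) (at 0)" by (rule eventually_mono) (rule eq)
  have "(P \<longlongrightarrow> G (z0 + 0)) (at 0)"
  proof -
    have "((\<lambda>w. G (z0 + w)) \<longlongrightarrow> G (z0 + 0)) (at 0)"
      using has_fps_expansion_imp_continuous[OF GF, of UNIV] by (simp add: continuous_within)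
    then show ?thesis by (rule Lim_transform_eventually) (rule ev)
  qed
  moreover have "(P \<longlongrightarrow> P 0) (at 0)"
    using has_fps_expansion_imp_continuous[OF P, of UNIV] by (simp add: continuous_within)
  ultimately have "G (z0 + 0) = P 0" using LIM_unique by blast
  with ev have "eventually (\<lambda>w. G (z0 + w) = P w) (nhds 0)"
    by (simp add: eventually_nhds_conv_at)
  then have "P has_fps_expansion GF"
    using GF has_fps_expansion_cong[OF _ refl, of "\<lambda>w. G (z0 + w)" P] by simp
  then have "GF = PF" using P fps_expansion_unique_complex by blast
  have "(deriv ^^ l) G z0 / fact l = fps_nth GF l"
    by (simp add: GF_def fps_expansion_def)
  also note \<open>GF = PF\<close>
  also have "fps_nth PF l = (\<Sum>k=1..m j. B j k * c ^ (m j - k) * (if l = m j - k then 1 else 0))"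
  proof -
    have "(fps_const c * fps_X) ^ m j * KF = fps_X ^ m j * (fps_const c ^ m j * KF)"
      by (simp only: power_mult_distrib mult.assoc mult.commute mult.left_commute)
    moreover have "fps_nth (fps_X ^ m j * (fps_const c ^ m j * KF)) l = 0"
      using k unfolding fps_X_power_mult_nth by (simp add: l_def)
    ultimately have "fps_nth ((fps_const c * fps_X) ^ m j * KF) l = 0" by (simp only:)
    then show ?thesis
      unfolding PF_def fps_add_nth fps_sum_nth
      by (simp add: power_mult_distrib fps_X_power_nth mult.assoc) 
  qed
  also have "\<dots> = (\<Sum>k'=1..m j. if k' = k then B j k * c ^ l else 0)"
    using k by (intro sum.cong) (auto simp: l_def)
  also have "\<dots> = B j k * c ^ l" using k by simp
  finally have "B j k = (deriv ^^ l) G z0 / (fact l * c ^ l)"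
    using nz[OF j] by (simp add: c_def field_simps)
  also have "\<dots> = (-1) ^ l / (fact l * a j ^ l) * (deriv ^^ l) G z0"
    by (simp add: c_def power_minus[of "a j"] divide_simps)
  finally show ?thesis by (simp add: l_def G_def z0_def)
qed

theorem partial_fraction_power_series_coeff:
  assumes nz: "\<And>i. i \<in> I \<Longrightarrow> a i \<noteq> 0" and "\<exists>i\<in>I. m i \<noteq> 0"
  shows "fps_nth (\<Prod>i\<in>I. geometric_fps (a i) ^ m i) N =
    (\<Sum>i\<in>I. a i ^ N * (\<Sum>k=1..m i. (-1) ^ (m i - k) / (fact (m i - k) * a i ^ (m i - k)) *
      (deriv ^^ (m i - k)) (\<lambda>z. \<Prod>i'\<in>I - {i}. 1 / (1 - a i' * z) ^ m i') (1 / a i) * of_nat (p_poly k N)))"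
proof -
  obtain B where B: "\<And>z. \<forall>i\<in>I. a i * z \<noteq> 1 \<Longrightarrow>
      (\<Prod>i\<in>I. (1 / (1 - a i * z)) ^ m i) = (\<Sum>i\<in>I. \<Sum>k=1..m i. B i k * (1 / (1 - a i * z)) ^ k)"
    using partial_fraction_prod[OF assms(2)] unfolding partial_fraction_def by blast
  have "eventually (\<lambda>z. \<forall>i\<in>I. a i * z \<noteq> 1) (nhds 0)"
    unfolding eventually_ball_finite_distrib[OF fin]
  proof
    fix i
    have "((\<lambda>z. a i * z) \<longlongrightarrow> a i * 0) (nhds 0)"
      by (intro tendsto_mult tendsto_const filterlim_ident)
    then show "eventually (\<lambda>z. a i * z \<noteq> 1) (nhds 0)"
      by (rule tendsto_imp_eventually_ne) simp
  qed
  then have ev: "eventually (\<lambda>z. (\<Prod>i\<in>I. (1 / (1 - a i * z)) ^ m i) =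
      (\<Sum>i\<in>I. \<Sum>k=1..m i. B i k * (1 / (1 - a i * z)) ^ k)) (nhds 0)"
    by (rule eventually_mono) (rule B)
  have "(\<lambda>z. \<Prod>i\<in>I. (1 / (1 - a i * z)) ^ m i) has_fps_expansion (\<Prod>i\<in>I. geometric_fps (a i) ^ m i)"
    by (intro fps_expansion_intros has_fps_expansion_geometric)
  moreover have "(\<lambda>z. \<Sum>i\<in>I. \<Sum>k=1..m i. B i k * (1 / (1 - a i * z)) ^ k) has_fps_expansion
      (\<Sum>i\<in>I. \<Sum>k=1..m i. fps_const (B i k) * geometric_fps (a i) ^ k)"
    by (intro fps_expansion_intros has_fps_expansion_geometric)
  ultimately have "(\<Prod>i\<in>I. geometric_fps (a i) ^ m i) =
      (\<Sum>i\<in>I. \<Sum>k=1..m i. fps_const (B i k) * geometric_fps (a i) ^ k)"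
    using has_fps_expansion_cong[OF ev refl] fps_expansion_unique_complex by blast
  then have "fps_nth (\<Prod>i\<in>I. geometric_fps (a i) ^ m i) N =
      (\<Sum>i\<in>I. \<Sum>k=1..m i. B i k * (of_nat (p_poly k N) * a i ^ N))"
    by (simp add: fps_sum_nth fps_nth_geometric_power)
  also have "\<dots> = (\<Sum>i\<in>I. a i ^ N * (\<Sum>k=1..m i. B i k * of_nat (p_poly k N)))"
    by (simp add: sum_distrib_left mult_ac)
  also have "\<dots> = (\<Sum>i\<in>I. a i ^ N * (\<Sum>k=1..m i. (-1) ^ (m i - k) / (fact (m i - k) * a i ^ (m i - k)) *
      (deriv ^^ (m i - k)) (\<lambda>z. \<Prod>i'\<in>I - {i}. 1 / (1 - a i' * z) ^ m i') (1 / a i) * of_nat (p_poly k N)))"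
    by (intro sum.cong arg_cong2[of _ _ _ _ "(*)"] refl partial_fraction_coeff[OF nz B]) auto
  finally show ?thesis .
qed

end

section \<open>Weight bases of irreducible representations\<close>

context vector_space
begin

text \<open>
  Linear independence of eigenvectors, phrased for a family indexed by the eigenvalues in which some
  members may vanish. Applying \<open>T - d\<close> to the sum removes the term with the eigenvalue \<open>d\<close> and
  multiplies the others by nonzero scalars.
\<close>

lemma eigenvectors_sum_eq_0:
  assumes T: "Vector_Spaces.linear scale scale T" and "finite C"
    and "\<And>c. c \<in> C \<Longrightarrow> T (u c) = scale c (u c)" and "(\<Sum>c\<in>C. u c) = 0"
  shows "\<forall>c\<in>C. u c = 0"
  using assms(2-)
proof (induction C arbitrary: u rule: finite_induct)
  case (insert d C)
  interpret T: Vector_Spaces.linear scale scale T by fact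
  have sum0: "u d + (\<Sum>c\<in>C. u c) = 0" using insert by simp
  have "T (\<Sum>c\<in>insert d C. u c) - scale d (\<Sum>c\<in>insert d C. u c) = (\<Sum>c\<in>C. scale (c - d) (u c))"
    using insert.hyps insert.prems(1) by (simp add: T.add T.sum scale_right_distrib scale_sum_right scale_left_diff_distrib sum_subtractf)
  then have "(\<Sum>c\<in>C. scale (c - d) (u c)) = 0"
    unfolding insert.prems(2) by (simp add: T.zero)
  moreover have "T (scale (c - d) (u c)) = scale c (scale (c - d) (u c))" if "c \<in> C" for c
    using insert.prems(1) that by (simp add: T.scale mult.commute)
  ultimately have *: "\<forall>c\<in>C. scale (c - d) (u c) = 0"
    by (intro insert.IH)
  have "u c = 0" if "c \<in> C" for c
    using *[rule_format, OF that] insert.hyps(2) that by (auto simp only: scale_eq_0_iff right_minus_eq)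
  then have "\<forall>c\<in>C. u c = 0" by blast
  with sum0 show ?case by simp
qed simp

lemma finite_eigenvalues:
  assumes T: "Vector_Spaces.linear scale scale T" and E: "finite E" "span E = UNIV"
  shows "finite {c. \<exists>v. v \<noteq> 0 \<and> T v = scale c v}"
proof (rule ccontr)
  assume "infinite {c. \<exists>v. v \<noteq> 0 \<and> T v = scale c v}"
  then obtain C where C: "finite C" "card C = Suc (card E)" "C \<subseteq> {c. \<exists>v. v \<noteq> 0 \<and> T v = scale c v}"
    using infinite_arbitrarily_large by blast
  then have "\<forall>c\<in>C. \<exists>v. v \<noteq> 0 \<and> T v = scale c v" by auto
  from bchoice[OF this] obtain v where v: "\<And>c. c \<in> C \<Longrightarrow> v c \<noteq> 0 \<and> T (v c) = scale c (v c)"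
    by blast
  interpret T: Vector_Spaces.linear scale scale T by fact
  have inj: "inj_on v C"
  proof (rule inj_onI)
    fix c d assume cd: "c \<in> C" "d \<in> C" "v c = v d"
    then have "scale c (v c) = scale d (v c)" using v by metis
    then show "c = d" using v cd by auto
  qed
  have "\<forall>w\<in>v ` C. a w = 0" if "(\<Sum>w\<in>v ` C. scale (a w) w) = 0" for a
  proof -
    have "(\<Sum>c\<in>C. scale (a (v c)) (v c)) = 0" using that by (simp add: sum.reindex[OF inj])
    then have "\<forall>c\<in>C. scale (a (v c)) (v c) = 0"
      using v C by (intro eigenvectors_sum_eq_0[OF T]) (auto simp: T.scale mult.commute)
    then show ?thesis using v by auto
  qed
  then have "independent (v ` C)" using C(1) by (auto simp: dependent_finite)
  then have "card (v ` C) \<le> card E" using independent_span_bound[OF E(1)] E(2) by auto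
  then show False using C(2) by (simp add: card_image[OF inj])
qed

text \<open>
  The family \<open>u\<close> assigns an eigenvector, possibly zero, to every scalar, not only to those in
  \<open>C\<close>; this keeps the induction free of side conditions.
\<close>

lemma eigenvector_decomposition:
  assumes T: "Vector_Spaces.linear scale scale T" and v: "v \<in> span {v. \<exists>c. T v = scale c v}"
  obtains C u where "finite C" "\<And>c. T (u c) = scale c (u c)" "v = (\<Sum>c\<in>C. u c)"
proof -
  interpret T: Vector_Spaces.linear scale scale T by fact
  have "\<exists>C u. finite C \<and> (\<forall>c. T (u c) = scale c (u c)) \<and> v = (\<Sum>c\<in>C. u c)"
    using v
  proof (induction rule: span_induct_alt)
    case base
    show ?case by (intro exI[of _ "{}"] exI[of _ "\<lambda>_. 0"]) (simp add: T.zero)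
  next
    case (step a b v)
    then obtain d C u where b: "T b = scale d b" and C: "finite C" "\<And>c. T (u c) = scale c (u c)" "v = (\<Sum>c\<in>C. u c)"
      by auto
    define u0 where "u0 = (\<lambda>c. if c \<in> C then u c else 0)"
    define u' where "u' = u0(d := scale a b + u0 d)"
    have u0: "T (u0 c) = scale c (u0 c)" for c using C by (simp add: u0_def T.zero)
    have "T (u' c) = scale c (u' c)" for c
      using u0 b by (simp add: u'_def T.add T.scale scale_right_distrib mult.commute)
    moreover have "scale a b + v = (\<Sum>c\<in>insert d C. u' c)"
    proof -
      have "v = (\<Sum>c\<in>insert d C. u0 c)"
        unfolding C(3) using C(1) by (intro sum.mono_neutral_cong_left) (auto simp: u0_def)
      also have "\<dots> = u0 d + (\<Sum>c\<in>C - {d}. u0 c)"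
        using C(1) by (simp add: sum.insert_remove)
      also have "(\<Sum>c\<in>C - {d}. u0 c) = (\<Sum>c\<in>C - {d}. u' c)"
        by (intro sum.cong) (auto simp: u'_def)
      finally show ?thesis using C(1) by (simp add: sum.insert_remove u'_def add.assoc)
    qed
    ultimately show ?case using C(1) by (intro exI[of _ "insert d C"] exI[of _ u']) auto
  qed
  then show thesis using that by blast
qed

text \<open>
  Decompose a joint eigenvector of the first \<open>n\<close> operators into eigenvectors of the next one.
  Since the operators commute, the components are again joint eigenvectors of the first \<open>n\<close>.
\<close>

lemma joint_diagonalization:
  fixes T :: "nat \<Rightarrow> 'b \<Rightarrow> 'b"
  assumes "\<And>j. j < n \<Longrightarrow> Vector_Spaces.linear scale scale (T j)"
    and "\<And>i j v. i < n \<Longrightarrow> j < n \<Longrightarrow> T i (T j v) = T j (T i v)"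
    and "\<And>j. j < n \<Longrightarrow> span {v. \<exists>c. T j v = scale c v} = UNIV"
  shows "span {v. \<forall>j<n. \<exists>c. T j v = scale c v} = UNIV"
  using assms
proof (induction n)
  case (Suc n)
  let ?J = "\<lambda>n. {v. \<forall>j<n. \<exists>c. T j v = scale c v}"
  have "?J n \<subseteq> span (?J (Suc n))"
  proof
    fix v assume v: "v \<in> ?J n"
    have "v \<in> span {v. \<exists>c. T n v = scale c v}" using Suc.prems(3)[of n] by simp
    then obtain C u where C: "finite C" "\<And>c. T n (u c) = scale c (u c)" "v = (\<Sum>c\<in>C. u c)"
      by (rule eigenvector_decomposition[OF Suc.prems(1)[OF lessI]]) blast
    have "u c \<in> ?J (Suc n)" if "c \<in> C" for c
    proof -
      have "\<exists>d. T j (u c) = scale d (u c)" if j: "j < n" for j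
      proof -
        interpret Tj: Vector_Spaces.linear scale scale "T j" using Suc.prems(1) j by simp
        interpret Tn: Vector_Spaces.linear scale scale "T n" using Suc.prems(1) by simp
        obtain d where d: "T j v = scale d v" using v j by blast
        \<comment> \<open>\<open>T j - d\<close> maps each eigenspace of \<open>T n\<close> into itself and kills the sum.\<close>
        have "(\<Sum>c\<in>C. T j (u c) - scale d (u c)) = T j v - scale d v"
          by (simp add: C(3) Tj.sum scale_sum_right sum_subtractf)
        then have "(\<Sum>c\<in>C. T j (u c) - scale d (u c)) = 0" using d by simp
        moreover have "T n (T j (u c) - scale d (u c)) = scale c (T j (u c) - scale d (u c))" for c
          using Suc.prems(2)[of n j "u c"] j
          by (simp add: Tn.diff Tn.scale C(2) Tj.scale scale_right_diff_distrib mult.commute)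
        ultimately have "\<forall>c\<in>C. T j (u c) - scale d (u c) = 0"
          by (intro eigenvectors_sum_eq_0[OF Suc.prems(1)[of n] C(1)]) auto
        then show ?thesis using \<open>c \<in> C\<close> by auto
      qed
      then show ?thesis using C(2) by (auto simp: less_Suc_eq)
    qed
    then show "v \<in> span (?J (Suc n))" unfolding C(3) by (intro span_sum span_base)
  qed
  then have "span (?J n) \<subseteq> span (?J (Suc n))" by (intro span_minimal) auto
  moreover have "span (?J n) = UNIV" using Suc by simp
  ultimately show ?case by auto
qed (simp add: span_UNIV)

end

text \<open>
  Applying \<open>e\<close> repeatedly to \<open>v\<close> raises the eigenvalue by 2 each time, so after some
  number \<open>k\<close> of steps a nonzero vector \<open>w\<close> killed by \<open>e\<close> is reached, with eigenvalue
  \<open>b = c + 2 k\<close>. Going down from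
  \<open>w\<close> by \<open>f\<close> also ends, say \<open>f\<^sup>n w \<noteq> 0\<close> and \<open>f\<^bsup>n+1\<^esup> w = 0\<close>, and
  \<open>e f\<^bsup>n+1\<^esup> w = (n + 1) (b - n) f\<^sup>n w\<close> forces \<open>b = n\<close>.
\<close>

lemma sl2_eigenvalue_integer:
  fixes s :: "complex \<Rightarrow> 'v::ab_group_add \<Rightarrow> 'v"
  assumes "vector_space s" and fin: "finite_dim s"
    and lin: "Vector_Spaces.linear s s e" "Vector_Spaces.linear s s h" "Vector_Spaces.linear s s f"
    and he: "\<And>v. h (e v) = e (h v) + s 2 (e v)"
    and hf: "\<And>v. h (f v) = f (h v) - s 2 (f v)"
    and ef: "\<And>v. e (f v) = f (e v) + h v"
    and v: "v \<noteq> 0" "h v = s c v"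
  shows "c \<in> \<int>"
proof -
  interpret vector_space s by fact
  interpret e: Vector_Spaces.linear s s e by fact
  interpret h: Vector_Spaces.linear s s h by fact
  interpret f: Vector_Spaces.linear s s f by fact
  obtain E where E: "finite E" "span E = UNIV" using fin by (auto simp: finite_dim_def)
  \<comment> \<open>A chain of eigenvectors along an arithmetic progression of eigenvalues breaks off.\<close>
  have nilpotent: "\<exists>n. w n \<noteq> 0 \<and> w (Suc n) = 0"
    if w: "w 0 \<noteq> 0" "\<And>n. h (w n) = s (a + of_nat n * d) (w n)" and d: "d \<noteq> 0"
    for w :: "nat \<Rightarrow> 'v" and a d
  proof (rule ccontr)
    assume "\<not> (\<exists>n. w n \<noteq> 0 \<and> w (Suc n) = 0)"
    then have "w n \<noteq> 0" for n using w(1) by (induction n) auto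
    then have "range (\<lambda>n. a + of_nat n * d) \<subseteq> {c. \<exists>v. v \<noteq> 0 \<and> h v = s c v}" using w(2) by auto
    then have "finite (range (\<lambda>n::nat. a + of_nat n * d))"
      using finite_eigenvalues[OF lin(2) E] finite_subset by blast
    moreover have "inj (\<lambda>n::nat. a + of_nat n * d)" using d by (auto simp: inj_def)
    ultimately show False using finite_imageD infinite_UNIV_nat by blast
  qed
  have "h ((e ^^ n) v) = s (c + of_nat n * 2) ((e ^^ n) v)" for n
    by (induction n) (simp_all add: v he e.scale algebra_simps flip: scale_left_distrib)
  then obtain k where k: "(e ^^ k) v \<noteq> 0" "(e ^^ Suc k) v = 0"
    using nilpotent[of "\<lambda>n. (e ^^ n) v" c 2] v by auto
  define w where "w = (e ^^ k) v"
  define b where "b = c + of_nat k * 2"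
  have hw: "h w = s b w" unfolding w_def b_def by fact
  have ew: "e w = 0" using k by (simp add: w_def)
  have hfw: "h ((f ^^ n) w) = s (b + of_nat n * (-2)) ((f ^^ n) w)" for n
    by (induction n) (simp_all add: hw hf f.scale algebra_simps flip: scale_left_diff_distrib)
  then obtain n where n: "(f ^^ n) w \<noteq> 0" "(f ^^ Suc n) w = 0"
    using nilpotent[of "\<lambda>n. (f ^^ n) w" b "-2"] k by (auto simp: w_def)
  have "e ((f ^^ Suc n) w) = s (of_nat (Suc n) * (b - of_nat n)) ((f ^^ n) w)" for n
  proof (induction n)
    case 0
    show ?case by (simp add: ef ew f.zero hw)
  next
    case (Suc n)
    have "e ((f ^^ Suc (Suc n)) w) = f (e ((f ^^ Suc n) w)) + h ((f ^^ Suc n) w)"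
      by (simp add: ef)
    also have "\<dots> = s (of_nat (Suc n) * (b - of_nat n)) ((f ^^ Suc n) w)
        + s (b + of_nat (Suc n) * (-2)) ((f ^^ Suc n) w)"
      unfolding Suc.IH hfw by (simp add: f.scale)
    also have "\<dots> = s (of_nat (Suc (Suc n)) * (b - of_nat (Suc n))) ((f ^^ Suc n) w)"
      unfolding scale_left_distrib[symmetric] by (simp add: algebra_simps)
    finally show ?case .
  qed
  from this[of n] n have "of_nat (Suc n) * (b - of_nat n) = 0" by (simp add: e.zero del: of_nat_Suc)
  then have "b = of_nat n" by (simp del: of_nat_Suc)
  then have "c = of_nat n - of_nat k * 2" by (simp add: b_def algebra_simps)
  then show ?thesis by simp
qed

text \<open>
  The span of all eigenvectors of \<open>\<rho> h\<close> is a subrepresentation: if \<open>[h, x] = d x\<close>, then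
  \<open>\<rho> x\<close> maps eigenvectors for \<open>c\<close> to eigenvectors for \<open>c + d\<close>, and such \<open>x\<close>
  span the Lie algebra. Being nonzero, it is everything.
\<close>

lemma rep_diagonalizable:
  assumes rep: "lie_representation s br sV \<rho>" and irr: "irreducible_rep sV \<rho>"
    and diag: "diagonalizable s (br h)" and "vector_space s"
    and v: "v \<noteq> 0" "\<rho> h v = sV c v"
  shows "diagonalizable sV (\<rho> h)"
proof -
  interpret G: vector_space s by fact
  interpret V: vector_space sV using rep by (simp add: lie_representation_def)
  interpret R: Vector_Spaces.linear sV sV "\<rho> x" for x using rep by (simp add: lie_representation_def)
  interpret L: Vector_Spaces.linear s sV "\<lambda>x. \<rho> x u" for u using rep by (simp add: lie_representation_def)
  let ?E = "{v. \<exists>c. \<rho> h v = sV c v}"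
  have inv: "\<rho> x w \<in> V.span ?E" if w: "w \<in> V.span ?E" for x w
    using w
  proof (induction rule: V.span_induct_alt)
    case base
    show ?case by (simp add: R.zero V.span_zero)
  next
    case (step a b w)
    then obtain c where c: "\<rho> h b = sV c b" by auto
    have "x \<in> G.span {x. \<exists>c. br h x = s c x}" using diag by (simp add: diagonalizable_def)
    then have "\<rho> x b \<in> V.span ?E"
    proof (induction rule: G.span_induct_alt)
      case base
      show ?case by (simp add: L.zero V.span_zero)
    next
      case (step a' y z)
      then obtain d where d: "br h y = s d y" by auto
      have "\<rho> (br h y) b = \<rho> h (\<rho> y b) - \<rho> y (\<rho> h b)"
        using rep by (simp add: lie_representation_def)
      then have "\<rho> h (\<rho> y b) = sV (d + c) (\<rho> y b)"
        by (simp add: c d L.scale R.scale V.scale_left_distrib algebra_simps)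
      then have "\<rho> y b \<in> V.span ?E" by (auto intro: V.span_base)
      then show ?case using step by (simp add: L.add L.scale V.span_add V.span_scale)
    qed
    then show ?case using step by (simp add: R.add R.scale V.span_add V.span_scale)
  qed
  have "V.span ?E = {0} \<or> V.span ?E = UNIV"
    using irr inv unfolding irreducible_rep_def by auto
  moreover have "v \<in> V.span ?E" 
    using v(2) by (intro V.span_base) blast
  ultimately show ?thesis using v(1) by (auto simp: diagonalizable_def)
qed

lemma linear_form_on_sum:
  assumes "linear_form_on s H \<phi>" "module.subspace s H" "vector_space s" "\<And>j. j \<in> A \<Longrightarrow> x j \<in> H"
  shows "\<phi> (\<Sum>j\<in>A. s (a j) (x j)) = (\<Sum>j\<in>A. a j * \<phi> (x j))"
  using assms(4)
proof (induction A rule: infinite_finite_induct)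
  interpret vector_space s by fact
  have zero: "\<phi> 0 = 0"
  proof -
    have "\<phi> (s 0 0) = 0 * \<phi> 0"
      using assms(1) subspace_0[OF assms(2)] unfolding linear_form_on_def by blast
    then show ?thesis by simp
  qed
  {
    case (infinite A)
    then show ?case by (simp add: zero)
  next
    case empty
    then show ?case by (simp add: zero)
  next
    case (insert i A)
    have "(\<Sum>j\<in>A. s (a j) (x j)) \<in> H"
      using insert by (intro subspace_sum[OF assms(2)] subspace_scale[OF assms(2)]) auto
    moreover have "x i \<in> H" "s (a i) (x i) \<in> H"
      using insert subspace_scale[OF assms(2)] by auto
    ultimately show ?case
      using assms(1) insert by (simp add: linear_form_on_def)
  }
qed

text \<open>
  The coroots are linearly independent, having a dual family, and there are as many of them as the
  dimension of \<open>H\<close>. So they form a basis of \<open>H\<close>, and the dual family reads off coordinates.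
\<close>

lemma cartan_coroot_expansion:
  assumes "vector_space s" "finite_dim s" "module.subspace s H" "vector_space.dim s H = r"
    and coroots: "\<And>j. j < r \<Longrightarrow> \<alpha>c j \<in> H" and \<omega>: "fundamental_weights s H r \<alpha>c \<omega>" and h: "h \<in> H"
  shows "h = (\<Sum>j<r. s (\<omega> j h) (\<alpha>c j))"
proof -
  interpret vector_space s by fact
  obtain E where E: "finite E" "span E = UNIV" using assms(2) by (auto simp: finite_dim_def)
  have lin: "linear_form_on s H (\<omega> i)" if "i < r" for i
    using \<omega> that by (simp add: fundamental_weights_def)
  have \<omega>_\<alpha>: "\<omega> i (\<alpha>c j) = (if i = j then 1 else 0)" if "i < r" "j < r" for i j
    using \<omega> that by (simp add: fundamental_weights_def)
  have \<omega>_sum: "\<omega> i (\<Sum>j<r. s (a j) (\<alpha>c j)) = a i" if "i < r" for i a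
  proof -
    have "\<omega> i (\<Sum>j<r. s (a j) (\<alpha>c j)) = (\<Sum>j<r. a j * \<omega> i (\<alpha>c j))"
      using coroots by (intro linear_form_on_sum[OF lin[OF that] assms(3,1)]) auto
    also have "\<dots> = (\<Sum>j<r. if j = i then a i else 0)" using that by (intro sum.cong) (auto simp: \<omega>_\<alpha>)
    finally show ?thesis using that by simp
  qed
  let ?A = "\<alpha>c ` {..<r}"
  have inj: "inj_on \<alpha>c {..<r}"
    by (rule inj_onI) (metis \<omega>_\<alpha> lessThan_iff one_neq_zero)
  have indep: "independent ?A"
  proof -
    have "\<forall>w\<in>?A. a w = 0" if "(\<Sum>w\<in>?A. s (a w) w) = 0" for a
    proof -
      have 0: "(\<Sum>j<r. s (a (\<alpha>c j)) (\<alpha>c j)) = 0" using that by (simp add: sum.reindex[OF inj])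
      have "a (\<alpha>c i) = 0" if "i < r" for i
        using \<omega>_sum[OF that, of "\<lambda>j. a (\<alpha>c j)"] \<omega>_sum[OF that, of "\<lambda>_. 0"] 0 by simp
      then show ?thesis by auto
    qed
    then show ?thesis by (auto simp: dependent_finite)
  qed
  have "H \<subseteq> span ?A"
  proof (rule ccontr)
    assume "\<not> H \<subseteq> span ?A"
    then obtain x where x: "x \<in> H" "x \<notin> span ?A" by auto
    obtain D where D: "insert x ?A \<subseteq> D" "D \<subseteq> H" "independent D" "H \<subseteq> span D"
      using maximal_independent_subset_extend[of "insert x ?A" H] independent_insertI[OF x(2) indep] x coroots
      by auto
    have "card D = r" using basis_card_eq_dim[OF D(2,4,3)] assms(4) by simp
    moreover have "finite D" using independent_span_bound[OF E(1) D(3)] E(2) by simp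
    then have "card (insert x ?A) \<le> card D" using D(1) card_mono by blast
    moreover have "x \<notin> ?A" using x(2) by (auto intro: span_base)
    ultimately show False using card_image[OF inj] by simp
  qed
  then have "h \<in> span ?A" using h by blast
  then obtain a where "h = (\<Sum>w\<in>?A. s (a w) w)"
    unfolding span_finite[OF finite_imageI[OF finite_lessThan]] by (rule imageE)
  then have a: "h = (\<Sum>j<r. s (a (\<alpha>c j)) (\<alpha>c j))" unfolding sum.reindex[OF inj] by simp
  have "a (\<alpha>c i) = \<omega> i h" if "i < r" for i
    unfolding a using \<omega>_sum[OF that, of "\<lambda>j. a (\<alpha>c j)"] by (rule sym)
  then have "(\<Sum>j<r. s (a (\<alpha>c j)) (\<alpha>c j)) = (\<Sum>j<r. s (\<omega> j h) (\<alpha>c j))"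
    by (intro sum.cong refl) simp
  then show ?thesis using a by (rule trans[rotated])
qed

text \<open>
  The coroots act on the representation by commuting diagonalizable operators, so there is a basis of
  joint eigenvectors. Each eigenvalue is an integer by the theory of \<open>sl\<^sub>2\<close>, applied to the triple
  that defines the coroot; these integers are the coordinates of the weight. Since the coroots span
  \<open>H\<close>, a joint eigenvector of the coroots is a weight vector for all of \<open>H\<close>. That
  the elements of \<open>H\<close> act diagonalizably follows from irreducibility, starting from a single weight
  vector.
\<close>

theorem weight_basis_exists:
  assumes lie: "lie_algebra s br" "finite_dim s" and cartan: "cartan_subalgebra s br H"
    and dim: "vector_space.dim s H = r"
    and coroots: "\<And>j. j < r \<Longrightarrow> is_coroot s br H (\<alpha> j) (\<alpha>c j)"
    and \<omega>: "fundamental_weights s H r \<alpha>c \<omega>"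
    and rep: "lie_representation s br sV \<rho>" and irr: "irreducible_rep sV \<rho>"
    and hw: "\<exists>v. v \<noteq> 0 \<and> v \<in> weight_space sV \<rho> H \<phi>"
  obtains Basis wt where "finite_dimensional_vector_space sV Basis"
    "\<And>b. b \<in> Basis \<Longrightarrow> wt b \<in> weight_lattice r"
    "\<And>h b. h \<in> H \<Longrightarrow> b \<in> Basis \<Longrightarrow> \<rho> h b = sV (weight_form \<omega> r (wt b) h) b"
proof -
  have vsG: "vector_space s" using lie by (simp add: lie_algebra_def)
  have vsV: "vector_space sV" "finite_dim sV" using rep by (auto simp: lie_representation_def)
  interpret G: vector_space s by fact
  interpret V: vector_space sV by fact
  have linV: "Vector_Spaces.linear sV sV (\<rho> x)" for x using rep by (simp add: lie_representation_def)
  interpret R: Vector_Spaces.linear sV sV "\<rho> x" for x by (rule linV)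
  interpret L: Vector_Spaces.linear s sV "\<lambda>x. \<rho> x u" for u using rep by (simp add: lie_representation_def)
  have \<rho>_br: "\<rho> (br x y) v = \<rho> x (\<rho> y v) - \<rho> y (\<rho> x v)" for x y v
    using rep by (simp add: lie_representation_def)
  have H: "module.subspace s H" "\<And>x y. x \<in> H \<Longrightarrow> y \<in> H \<Longrightarrow> br x y = 0"
    "\<And>h. h \<in> H \<Longrightarrow> diagonalizable s (br h)"
    using cartan by (auto simp: cartan_subalgebra_def)
  have \<alpha>cH: "\<alpha>c j \<in> H" if "j < r" for j using coroots[OF that] by (simp add: is_coroot_def)
  have diag: "diagonalizable sV (\<rho> h)" if h: "h \<in> H" for h
  proof -
    obtain v where "v \<noteq> 0" "\<rho> h v = sV (\<phi> h) v" using hw h by (auto simp: weight_space_def)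
    then show ?thesis by (rule rep_diagonalizable[OF rep irr H(3)[OF h] vsG])
  qed
  let ?J = "{v. \<forall>j<r. \<exists>c. \<rho> (\<alpha>c j) v = sV c v}"
  have "V.span ?J = UNIV"
  proof (rule V.joint_diagonalization)
    show "\<rho> (\<alpha>c i) (\<rho> (\<alpha>c j) v) = \<rho> (\<alpha>c j) (\<rho> (\<alpha>c i) v)" if "i < r" "j < r" for i j v
      using \<rho>_br[of "\<alpha>c i" "\<alpha>c j" v] H(2) \<alpha>cH that by (simp add: L.zero)
    show "V.span {v. \<exists>c. \<rho> (\<alpha>c j) v = sV c v} = UNIV" if "j < r" for j
      using diag[OF \<alpha>cH[OF that]] by (simp add: diagonalizable_def)
  qed (rule linV)
  moreover obtain Basis where B: "Basis \<subseteq> ?J" "V.independent Basis" "?J \<subseteq> V.span Basis"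
    using V.maximal_independent_subset by blast
  ultimately have spanB: "V.span Basis = UNIV"
    by (metis (no_types, lifting) V.span_minimal V.subspace_span top.extremum_uniqueI)
  obtain E where E: "finite E" "V.span E = UNIV" using vsV by (auto simp: finite_dim_def)
  have finB: "finite Basis" using V.independent_span_bound[OF E(1) B(2)] E(2) by simp
  have integral: "c \<in> \<int>" if j: "j < r" and v: "v \<noteq> 0" "\<rho> (\<alpha>c j) v = sV c v" for j c v
  proof -
    obtain e f where e: "e \<in> root_space s br H (\<alpha> j)" and f: "f \<in> root_space s br H (\<lambda>h. - \<alpha> j h)"
      and ef: "br e f = \<alpha>c j" and two: "\<alpha> j (\<alpha>c j) = 2"
      using coroots[OF j] by (auto simp: is_coroot_def)
    have te: "br (\<alpha>c j) e = s 2 e" "br (\<alpha>c j) f = s (- 2) f"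
      using e f two \<alpha>cH[OF j] by (auto simp: weight_space_def)
    show ?thesis
    proof (rule sl2_eigenvalue_integer[OF vsV linV linV linV _ _ _ v])
      show "\<rho> (\<alpha>c j) (\<rho> e v) = \<rho> e (\<rho> (\<alpha>c j) v) + sV 2 (\<rho> e v)" for v
        using \<rho>_br[of "\<alpha>c j" e v] by (simp add: te L.scale algebra_simps)
      show "\<rho> (\<alpha>c j) (\<rho> f v) = \<rho> f (\<rho> (\<alpha>c j) v) - sV 2 (\<rho> f v)" for v
        using \<rho>_br[of "\<alpha>c j" f v] by (simp add: te L.scale L.neg algebra_simps)
      show "\<rho> e (\<rho> f v) = \<rho> f (\<rho> e v) + \<rho> (\<alpha>c j) v" for v
        using \<rho>_br[of e f v] by (simp add: ef algebra_simps)
    qed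
  qed
  have "\<exists>w. w \<in> weight_lattice r \<and> (\<forall>j<r. \<rho> (\<alpha>c j) b = sV (of_int (w j)) b)" if b: "b \<in> Basis" for b
  proof -
    have "b \<noteq> 0" using b B(2) V.dependent_zero by blast
    have "\<exists>n. \<rho> (\<alpha>c j) b = sV (of_int n) b" if j: "j < r" for j
    proof -
      obtain c where "\<rho> (\<alpha>c j) b = sV c b" using b B(1) j by blast
      then show ?thesis using integral[OF j \<open>b \<noteq> 0\<close>] by (metis Ints_cases)
    qed
    then obtain n where "\<And>j. j < r \<Longrightarrow> \<rho> (\<alpha>c j) b = sV (of_int (n j)) b" by metis
    then show ?thesis
      by (intro exI[of _ "\<lambda>j. if j < r then n j else 0"]) (auto simp: weight_lattice_def)
  qed
  then obtain wt where wt: "\<And>b. b \<in> Basis \<Longrightarrow> wt b \<in> weight_lattice r"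
    "\<And>b j. b \<in> Basis \<Longrightarrow> j < r \<Longrightarrow> \<rho> (\<alpha>c j) b = sV (of_int (wt b j)) b" by metis
  have "\<rho> h b = sV (weight_form \<omega> r (wt b) h) b" if "h \<in> H" "b \<in> Basis" for h b
  proof -
    have "\<rho> h b = \<rho> (\<Sum>j<r. s (\<omega> j h) (\<alpha>c j)) b"
      using cartan_coroot_expansion[OF vsG lie(2) H(1) dim \<alpha>cH \<omega> that(1)] by simp
    also have "\<dots> = (\<Sum>j<r. sV (\<omega> j h * of_int (wt b j)) b)"
      using wt(2)[OF that(2)] by (simp add: L.sum L.scale)
    also have "\<dots> = sV (weight_form \<omega> r (wt b) h) b"
      by (simp add: weight_form_def V.scale_sum_left mult.commute)
    finally show ?thesis .
  qed
  moreover have "finite_dimensional_vector_space sV Basis"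
    using finB B(2) spanB by unfold_locales
  ultimately show thesis using that wt(1) by blast
qed

section \<open>Bases of symmetric powers\<close>

text \<open>
  The dimension of the quotient is given by a definite description, so two bases of the quotient must be
  shown to have the same size. Given \<open>E\<close> and \<open>E'\<close>, move each element of \<open>E'\<close> into
  \<open>span E\<close> by subtracting an element of \<open>R\<close>. The resulting family stays independent, because
  \<open>span E'\<close> meets \<open>R\<close> trivially; so it has at most \<open>card E\<close> elements.
\<close>

lemma quotient_dim_eqI:
  assumes "vector_space s" and "module.subspace s R" and "finite E" and "E \<subseteq> U"
    and "\<not> module.dependent s E" and "module.span s E \<inter> R = {0}"
    and "module.span s (E \<union> R) = U"
  shows "quotient_dim s U R = card E"
proof -
  interpret vector_space s by fact
  let ?P = "\<lambda>E. finite E \<and> E \<subseteq> U \<and> independent E \<and> span E \<inter> R = {0} \<and> span (E \<union> R) = U"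
  have le: "card E' \<le> card E" if E': "?P E'" and E: "?P E" for E E'
  proof -
    have "\<exists>y\<in>span E. x - y \<in> R" if "x \<in> E'" for x
    proof -
      have "x \<in> span (E \<union> R)" using that E' E by auto
      then obtain y z where "y \<in> span E" "z \<in> span R" "x = y + z"
        unfolding span_Un by auto
      moreover have "span R = R" using assms(2) by (simp add: span_eq_iff)
      ultimately show ?thesis by (intro bexI[of _ y]) auto
    qed
    then obtain f where f: "\<And>x. x \<in> E' \<Longrightarrow> f x \<in> span E \<and> x - f x \<in> R" by metis
    \<comment> \<open>A relation among the \<open>f x\<close> puts the same combination of \<open>E'\<close> into \<open>R\<close>.\<close>
    have rel: "\<forall>x\<in>E'. u x = 0" if "(\<Sum>x\<in>E'. s (u x) (f x)) = 0" for u
    proof -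
      have "(\<Sum>x\<in>E'. s (u x) x) = (\<Sum>x\<in>E'. s (u x) (x - f x))"
        using that by (simp add: scale_right_diff_distrib sum_subtractf)
      also have "\<dots> \<in> R"
        using f by (intro subspace_sum[OF assms(2)] subspace_scale[OF assms(2)]) auto
      finally have "(\<Sum>x\<in>E'. s (u x) x) \<in> span E' \<inter> R"
        by (intro IntI span_sum span_scale span_base)
      then have "(\<Sum>x\<in>E'. s (u x) x) = 0" using E' by auto
      then show ?thesis using E' dependent_finite[of E'] by auto
    qed
    have inj: "inj_on f E'"
    proof (rule inj_onI, rule ccontr)
      fix x y assume xy: "x \<in> E'" "y \<in> E'" "f x = f y" "x \<noteq> y"
      define u :: "'a \<Rightarrow> complex" where "u = (\<lambda>z. if z = x then 1 else if z = y then -1 else 0)"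
      have "(\<Sum>z\<in>E'. s (u z) (f z)) = (\<Sum>z\<in>{x,y}. s (u z) (f z))"
        using xy E' by (intro sum.mono_neutral_right) (auto simp: u_def)
      also have "\<dots> = 0" using xy by (simp add: u_def)
      finally show False using rel[of u] xy by (auto simp: u_def)
    qed
    have "independent (f ` E')"
    proof -
      have "\<forall>v\<in>f ` E'. u v = 0" if "(\<Sum>v\<in>f ` E'. s (u v) v) = 0" for u
        using rel[of "u \<circ> f"] that by (simp add: sum.reindex[OF inj])
      moreover have "finite (f ` E')" using E' by simp
      ultimately show ?thesis by (auto simp: dependent_finite)
    qed
    then have "card (f ` E') \<le> card E"
      using independent_span_bound[of E "f ` E'"] E f by auto
    then show ?thesis by (simp add: card_image[OF inj])
  qed
  have "?P E" using assms by auto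
  then show ?thesis unfolding quotient_dim_def
    by (intro the_equality) (use le in \<open>metis\<close>, use le antisym in \<open>metis\<close>)
qed

interpretation free: vector_space "free_scale :: complex \<Rightarrow> ('b \<Rightarrow>\<^sub>0 complex) \<Rightarrow> _"
  by (rule vector_space_free_scale)

lemma lookup_free_scale [simp]: "Poly_Mapping.lookup (free_scale c w) k = c * Poly_Mapping.lookup w k"
  by (simp add: free_scale_def Poly_Mapping.map.rep_eq when_def)

lemma free_scale_single [simp]: "free_scale c (Poly_Mapping.single k d) = Poly_Mapping.single k (c * d)"
  by (rule poly_mapping_eqI) (simp add: lookup_single when_def)

lemma free_scale_conv_mult: "free_scale c w = Poly_Mapping.single 0 c * w"
  by (simp add: free_scale_def mult_map_scale_conv_mult)

lemma poly_mapping_sum_singles: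
  "w = (\<Sum>k\<in>Poly_Mapping.keys w. Poly_Mapping.single k (Poly_Mapping.lookup w k))"
  by (rule poly_mapping_eqI)
    (auto simp: lookup_sum lookup_single when_def in_keys_iff if_distrib sum.delta cong: if_cong)

lemma span_free_singles:
  "free.span ((\<lambda>k. Poly_Mapping.single k 1) ` K) = {w. Poly_Mapping.keys w \<subseteq> K}"
proof
  have "free.subspace {w::'a \<Rightarrow>\<^sub>0 complex. Poly_Mapping.keys w \<subseteq> K}"
    by (rule free.subspaceI) (auto simp: in_keys_iff lookup_add subset_iff, metis add.right_neutral)
  then show "free.span ((\<lambda>k. Poly_Mapping.single k 1) ` K) \<subseteq> {w. Poly_Mapping.keys w \<subseteq> K}"
    by (intro free.span_minimal) (auto)
  show "{w. Poly_Mapping.keys w \<subseteq> K} \<subseteq> free.span ((\<lambda>k. Poly_Mapping.single k 1) ` K)"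
  proof clarify
    fix w :: "'a \<Rightarrow>\<^sub>0 complex" assume K: "Poly_Mapping.keys w \<subseteq> K"
    have "(\<Sum>k\<in>Poly_Mapping.keys w. free_scale (Poly_Mapping.lookup w k) (Poly_Mapping.single k 1))
        \<in> free.span ((\<lambda>k. Poly_Mapping.single k 1) ` K)"
      using K by (intro free.span_sum free.span_scale free.span_base) auto
    then show "w \<in> free.span ((\<lambda>k. Poly_Mapping.single k 1) ` K)"
      using poly_mapping_sum_singles[of w] by simp
  qed
qed

lemma independent_free_singles:
  "free.independent ((\<lambda>k. Poly_Mapping.single k 1) ` K)"
  unfolding free.dependent_def
proof clarify
  fix k assume "k \<in> K"
    and *: "Poly_Mapping.single k 1 \<in>
      free.span ((\<lambda>k. Poly_Mapping.single k 1) ` K - {Poly_Mapping.single k (1::complex)})"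
  have "((\<lambda>k. Poly_Mapping.single k (1::complex)) ` K - {Poly_Mapping.single k 1})
      \<subseteq> (\<lambda>k. Poly_Mapping.single k 1) ` (K - {k})" by auto
  from free.span_mono[OF this] * show False
    unfolding span_free_singles by auto
qed

lemma keys_free_scale_subset: "Poly_Mapping.keys (free_scale c w) \<subseteq> Poly_Mapping.keys w"
  by (auto simp: in_keys_iff)

definition linear_extension :: "('b \<Rightarrow> ('c::comm_monoid_add \<Rightarrow>\<^sub>0 complex)) \<Rightarrow> ('b \<Rightarrow>\<^sub>0 complex) \<Rightarrow> ('c \<Rightarrow>\<^sub>0 complex)" where
  "linear_extension f w = (\<Sum>k\<in>Poly_Mapping.keys w. free_scale (Poly_Mapping.lookup w k) (f k))"

lemma linear_extension_superset:
  assumes "finite K" "Poly_Mapping.keys w \<subseteq> K"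
  shows "linear_extension f w = (\<Sum>k\<in>K. free_scale (Poly_Mapping.lookup w k) (f k))"
  unfolding linear_extension_def using assms
  by (intro sum.mono_neutral_left) (auto simp: in_keys_iff)

lemma linear_linear_extension:
  "Vector_Spaces.linear free_scale free_scale (linear_extension f)"
proof (unfold_locales)
  show "linear_extension f (w + w') = linear_extension f w + linear_extension f w'" for w w'
  proof -
    let ?K = "Poly_Mapping.keys w \<union> Poly_Mapping.keys w'"
    have "Poly_Mapping.keys (w + w') \<subseteq> ?K" by (rule Poly_Mapping.keys_add)
    then show ?thesis
      by (simp add: linear_extension_superset[of ?K] lookup_add free.scale_left_distrib sum.distrib)
  qed
  show "linear_extension f (free_scale c w) = free_scale c (linear_extension f w)" for c w
    using keys_free_scale_subset[of c w]
    by (simp add: linear_extension_superset[of "Poly_Mapping.keys w"] free.scale_sum_right)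
qed

lemma linear_extension_single [simp]:
  "linear_extension f (Poly_Mapping.single k c) = free_scale c (f k)"
  by (cases "c = 0") (simp_all add: linear_extension_def)

locale complex_basis = finite_dimensional_vector_space scale Basis
  for scale :: "complex \<Rightarrow> 'v::ab_group_add \<Rightarrow> 'v" and Basis
begin

text \<open>
  Polynomials in variables indexed by basis vectors are finitely supported functions on multisets
  of vectors: addition of multisets is multiplication of monomials. Their ring serves as a model of
  the symmetric algebra; a vector becomes the linear polynomial of its coordinates.
\<close>

definition coord_poly :: "'v \<Rightarrow> ('v multiset \<Rightarrow>\<^sub>0 complex)" where
  "coord_poly v = (\<Sum>b\<in>Basis. Poly_Mapping.single {#b#} (representation Basis v b))"

text \<open>
  The evaluation of formal combinations of tuples, induced by
  \<open>(v\<^sub>1, \<dots>, v\<^sub>N) \<mapsto> v\<^sub>1 \<cdots> v\<^sub>N\<close>. Its kernel on \<open>N\<close>-tuples turns out to be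
  the subspace of relations.
\<close>

definition sym_poly :: "('v list \<Rightarrow>\<^sub>0 complex) \<Rightarrow> ('v multiset \<Rightarrow>\<^sub>0 complex)" where
  "sym_poly = linear_extension (\<lambda>vs. prod_list (map coord_poly vs))"

sublocale sym_poly: Vector_Spaces.linear free_scale free_scale sym_poly
  unfolding sym_poly_def by (rule linear_linear_extension)

lemma coord_poly_add: "coord_poly (u + v) = coord_poly u + coord_poly v"
  using independent_Basis span_Basis
  by (simp add: coord_poly_def representation_add single_add sum.distrib)

lemma coord_poly_scale: "coord_poly (scale c v) = free_scale c (coord_poly v)"
  using independent_Basis span_Basis
  by (simp add: coord_poly_def representation_scale free.scale_sum_right)

lemma coord_poly_basis:
  assumes "b \<in> Basis" shows "coord_poly b = Poly_Mapping.single {#b#} 1"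
proof -
  have "coord_poly b = (\<Sum>b'\<in>Basis. if b' = b then Poly_Mapping.single {#b#} 1 else 0)"
    unfolding coord_poly_def using assms independent_Basis
    by (intro sum.cong) (auto simp: representation_basis)
  then show ?thesis using assms finite_Basis by simp
qed

lemma prod_list_coord_poly_basis:
  "set bs \<subseteq> Basis \<Longrightarrow> prod_list (map coord_poly bs) = Poly_Mapping.single (mset bs) 1"
  by (induction bs) (simp_all add: coord_poly_basis mult_single)

lemma sym_poly_single:
  "sym_poly (Poly_Mapping.single vs c) = free_scale c (prod_list (map coord_poly vs))"
  by (simp add: sym_poly_def)

lemma subspace_free_tuples: "free.subspace (free_tuples N :: ('v list \<Rightarrow>\<^sub>0 complex) set)"
proof -
  have "(free_tuples N :: ('v list \<Rightarrow>\<^sub>0 complex) set) = free.span ((\<lambda>k. Poly_Mapping.single k 1) ` {vs :: 'v list. length vs = N})"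
    unfolding span_free_singles by (auto simp: free_tuples_def)
  then show ?thesis by (rule ssubst) (rule free.subspace_span)
qed

lemma single_in_free_tuples: "length vs = N \<Longrightarrow> Poly_Mapping.single vs c \<in> free_tuples N"
  by (auto simp: free_tuples_def)

lemma subspace_sym_relations: "free.subspace (sym_relations scale N)"
  unfolding sym_relations_def by (rule free.subspace_span)

lemma sym_relations_add:
  "length xs + length ys + 1 = N \<Longrightarrow>
    Poly_Mapping.single (xs @ (u + v) # ys) 1 - Poly_Mapping.single (xs @ u # ys) 1
      - Poly_Mapping.single (xs @ v # ys) 1 \<in> sym_relations scale N"
  unfolding sym_relations_def by (rule free.span_base) blast

lemma sym_relations_scale:
  "length xs + length ys + 1 = N \<Longrightarrow>
    Poly_Mapping.single (xs @ scale c v # ys) 1 - Poly_Mapping.single (xs @ v # ys) c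
      \<in> sym_relations scale N"
  unfolding sym_relations_def by (rule free.span_base) blast

lemma sym_relations_permute:
  "length xs = N \<Longrightarrow> mset xs = mset ys \<Longrightarrow>
    Poly_Mapping.single xs 1 - Poly_Mapping.single ys 1 \<in> sym_relations scale N"
  unfolding sym_relations_def by (rule free.span_base) blast

lemma sym_relations_free_tuples: "sym_relations scale N \<subseteq> free_tuples N"
  unfolding sym_relations_def
  by (rule free.span_minimal[OF _ subspace_free_tuples])
    (auto intro!: free.subspace_diff[OF subspace_free_tuples] single_in_free_tuples dest: mset_eq_length)

lemma sym_poly_relations: "w \<in> sym_relations scale N \<Longrightarrow> sym_poly w = 0"
proof -
  have "free.subspace {w. sym_poly w = 0}" by (rule sym_poly.subspace_kernel)
  then have "sym_relations scale N \<subseteq> {w. sym_poly w = 0}"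
    unfolding sym_relations_def
  proof (rule free.span_minimal[rotated], intro Un_least subsetI; clarify)
    fix xs u v ys
    show "sym_poly (Poly_Mapping.single (xs @ (u + v) # ys) 1 - Poly_Mapping.single (xs @ u # ys) 1
       - Poly_Mapping.single (xs @ v # ys) 1) = 0"
      unfolding sym_poly.diff sym_poly_single by (simp add: coord_poly_add algebra_simps)
  next
    fix xs c v ys
    show "sym_poly (Poly_Mapping.single (xs @ scale c v # ys) 1 - Poly_Mapping.single (xs @ v # ys) c) = 0"
      by (simp add: sym_poly.diff sym_poly_single coord_poly_scale free_scale_conv_mult algebra_simps)
  next
    fix xs ys :: "'v list" assume "mset xs = mset ys"
    then have "prod_list (map coord_poly xs) = prod_list (map coord_poly ys)"
      by (metis mset_map prod_mset_prod_list)
    then show "sym_poly (Poly_Mapping.single xs 1 - Poly_Mapping.single ys 1) = 0"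
      by (simp add: sym_poly.diff sym_poly_single)
  qed
  then show "w \<in> sym_relations scale N \<Longrightarrow> sym_poly w = 0" by auto
qed

definition monomials :: "nat \<Rightarrow> 'v multiset set" where
  "monomials N = {M. set_mset M \<subseteq> Basis \<and> size M = N}"

text \<open>
  An arbitrary ordering of each multiset, so that every monomial in the basis vectors is represented
  by exactly one tuple.
\<close>

definition list_of_mset :: "'v multiset \<Rightarrow> 'v list" where
  "list_of_mset M = (SOME vs. mset vs = M)"

lemma mset_list_of_mset [simp]: "mset (list_of_mset M) = M"
  unfolding list_of_mset_def by (rule someI_ex) (rule ex_mset)

lemma inj_list_of_mset: "inj_on list_of_mset A"
  by (rule inj_onI) (metis mset_list_of_mset)

lemma finite_monomials: "finite (monomials N)"
  unfolding monomials_def by (rule finite_multisets_of_size[OF finite_Basis])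

text \<open>
  The vectors of a tuple are expanded in the basis one at a time: those in \<open>xs\<close> already belong to the
  basis, those in \<open>ys\<close> are still arbitrary. Once all vectors are basis vectors, the symmetry
  relations bring them into the chosen order.
\<close>

lemma tuple_in_span:
  assumes "length xs + length ys = N" "set xs \<subseteq> Basis"
  shows "Poly_Mapping.single (xs @ ys) 1 \<in>
    free.span ((\<lambda>M. Poly_Mapping.single (list_of_mset M) 1) ` monomials N \<union> sym_relations scale N)"
    (is "_ \<in> free.span ?S")
  using assms
proof (induction ys arbitrary: xs)
  case Nil
  let ?c = "list_of_mset (mset xs)"
  have "Poly_Mapping.single xs 1 - Poly_Mapping.single ?c 1 \<in> sym_relations scale N"
    using Nil by (intro sym_relations_permute) auto
  moreover have "Poly_Mapping.single ?c 1 \<in> ?S" using Nil by (auto simp: monomials_def)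
  ultimately have "(Poly_Mapping.single xs 1 - Poly_Mapping.single ?c 1) + Poly_Mapping.single ?c 1 \<in> free.span ?S"
    by (intro free.span_add free.span_base) auto
  then show ?case by simp
next
  case (Cons y ys)
  have "y \<in> span Basis" by (simp add: span_Basis)
  then show ?case
  proof (induction rule: span_induct_alt)
    case base
    have "Poly_Mapping.single (xs @ scale 0 0 # ys) 1 - Poly_Mapping.single (xs @ 0 # ys) (0::complex)
        \<in> sym_relations scale N"
      using Cons.prems by (intro sym_relations_scale) auto
    then show ?case by (intro free.span_base) auto
  next
    case (step c b v)
    have 1: "Poly_Mapping.single (xs @ (scale c b + v) # ys) 1 - Poly_Mapping.single (xs @ scale c b # ys) 1
        - Poly_Mapping.single (xs @ v # ys) (1::complex) \<in> sym_relations scale N"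
      using Cons.prems by (intro sym_relations_add) auto
    have 2: "Poly_Mapping.single (xs @ scale c b # ys) 1 - Poly_Mapping.single (xs @ b # ys) c
        \<in> sym_relations scale N"
      using Cons.prems by (intro sym_relations_scale) auto
    have "Poly_Mapping.single ((xs @ [b]) @ ys) 1 \<in> free.span ?S"
      using Cons.prems step by (intro Cons.IH) auto
    from free.span_scale[OF this, of c]
    have 3: "Poly_Mapping.single (xs @ b # ys) c \<in> free.span ?S" by simp
    have "Poly_Mapping.single (xs @ (scale c b + v) # ys) 1 =
      (Poly_Mapping.single (xs @ (scale c b + v) # ys) 1 - Poly_Mapping.single (xs @ scale c b # ys) 1
        - Poly_Mapping.single (xs @ v # ys) (1::complex)) +
      ((Poly_Mapping.single (xs @ scale c b # ys) 1 - Poly_Mapping.single (xs @ b # ys) c) +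
       (Poly_Mapping.single (xs @ b # ys) c + Poly_Mapping.single (xs @ v # ys) 1))"
      by (simp add: algebra_simps)
    also have "\<dots> \<in> free.span ?S"
      using 1 2 3 step by (intro free.span_add) (auto intro: free.span_base)
    finally show ?case .
  qed
qed

text \<open>
  Modulo the relations, every element is a combination of the chosen tuples of basis vectors. Together
  with the injectivity of \<open>sym_poly\<close> on such combinations, this identifies the symmetric power with
  the space of homogeneous polynomials.
\<close>

lemma free_tuples_normal_form:
  assumes "w \<in> free_tuples N"
  obtains w' where "Poly_Mapping.keys w' \<subseteq> list_of_mset ` monomials N" "w - w' \<in> sym_relations scale N"
proof -
  let ?S = "(\<lambda>M. Poly_Mapping.single (list_of_mset M) (1::complex)) ` monomials N"
  have "w \<in> free.span ((\<lambda>k. Poly_Mapping.single k 1) ` {vs. length vs = N})"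
    using assms unfolding span_free_singles by (auto simp: free_tuples_def)
  also have "\<dots> \<subseteq> free.span (?S \<union> sym_relations scale N)"
    using tuple_in_span[of "[]" _ N] by (intro free.span_minimal) auto
  finally obtain a b where ab: "a \<in> free.span ?S" "b \<in> free.span (sym_relations scale N)" "w = a + b"
    unfolding free.span_Un by auto
  have "?S = (\<lambda>k. Poly_Mapping.single k 1) ` (list_of_mset ` monomials N)" by auto
  then have "Poly_Mapping.keys a \<subseteq> list_of_mset ` monomials N"
    using ab(1) by (simp only: span_free_singles) simp
  moreover have "w - a \<in> sym_relations scale N"
    using ab free.span_eq_iff[THEN iffD2, OF subspace_sym_relations] by auto
  ultimately show thesis by (rule that)
qed

lemma lookup_sym_poly_normal:
  assumes "Poly_Mapping.keys w \<subseteq> list_of_mset ` monomials N" and "M \<in> monomials N"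
  shows "Poly_Mapping.lookup (sym_poly w) M = Poly_Mapping.lookup w (list_of_mset M)"
proof -
  have *: "prod_list (map coord_poly (list_of_mset M')) = Poly_Mapping.single M' 1"
    if "M' \<in> monomials N" for M'
    using that by (subst prod_list_coord_poly_basis) (auto simp: monomials_def simp flip: set_mset_mset)
  have "sym_poly w = (\<Sum>k\<in>list_of_mset ` monomials N.
      free_scale (Poly_Mapping.lookup w k) (prod_list (map coord_poly k)))"
    unfolding sym_poly_def using assms(1) by (intro linear_extension_superset) (auto simp: finite_monomials)
  also have "\<dots> = (\<Sum>M'\<in>monomials N. Poly_Mapping.single M' (Poly_Mapping.lookup w (list_of_mset M')))"
    by (subst sum.reindex[OF inj_list_of_mset]) (simp add: *)
  finally show ?thesis
    using assms(2) finite_monomials by (simp add: lookup_sum lookup_single when_def)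
qed

lemma normal_form_eq_0:
  assumes "Poly_Mapping.keys w \<subseteq> list_of_mset ` monomials N" and "sym_poly w = 0"
  shows "w = 0"
proof (rule ccontr)
  assume "w \<noteq> 0"
  then obtain k where "k \<in> Poly_Mapping.keys w"
    by (metis ex_in_conv in_keys_iff lookup_zero poly_mapping_eqI)
  then show False
    using assms lookup_sym_poly_normal[OF assms(1)] by (auto simp: in_keys_iff)
qed

lemma sym_relations_iff:
  "w \<in> sym_relations scale N \<longleftrightarrow> w \<in> free_tuples N \<and> sym_poly w = 0"
proof
  assume w: "w \<in> free_tuples N \<and> sym_poly w = 0"
  then obtain w' where w': "Poly_Mapping.keys w' \<subseteq> list_of_mset ` monomials N"
    "w - w' \<in> sym_relations scale N" using free_tuples_normal_form by blast
  then have "sym_poly w' = 0" using w sym_poly_relations[of "w - w'"] by (simp add: sym_poly.diff)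
  then have "w' = 0" using normal_form_eq_0 w'(1) by blast
  then show "w \<in> sym_relations scale N" using w' by simp
qed (use sym_relations_free_tuples sym_poly_relations in auto)

text \<open>
  The derivation of the polynomial ring that multiplies each variable \<open>b\<close> by
  \<open>\<theta> b\<close>. It corresponds to the action on symmetric powers of an operator that is diagonal in the
  basis.
\<close>

definition weight_op :: "('v \<Rightarrow> complex) \<Rightarrow> ('v multiset \<Rightarrow>\<^sub>0 complex) \<Rightarrow> ('v multiset \<Rightarrow>\<^sub>0 complex)" where
  "weight_op \<theta> p = Poly_Mapping.mapp (\<lambda>M c. (\<Sum>b\<in>#M. \<theta> b) * c) p"

lemma lookup_weight_op:
  "Poly_Mapping.lookup (weight_op \<theta> p) M = (\<Sum>b\<in>#M. \<theta> b) * Poly_Mapping.lookup p M"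
  by (simp add: weight_op_def lookup_mapp when_def in_keys_iff)

lemma linear_weight_op: "Vector_Spaces.linear free_scale free_scale (weight_op \<theta>)"
  by unfold_locales (auto intro!: poly_mapping_eqI simp: lookup_weight_op lookup_add algebra_simps)

lemma weight_op_single: "weight_op \<theta> (Poly_Mapping.single M c) = Poly_Mapping.single M ((\<Sum>b\<in>#M. \<theta> b) * c)"
  by (rule poly_mapping_eqI) (simp add: lookup_weight_op lookup_single when_def)

lemma weight_op_mult: "weight_op \<theta> (p * q) = weight_op \<theta> p * q + p * weight_op \<theta> q"
proof -
  interpret W: Vector_Spaces.linear free_scale free_scale "weight_op \<theta>" by (rule linear_weight_op)
  have *: "weight_op \<theta> (Poly_Mapping.single A c * Poly_Mapping.single B d) =
      weight_op \<theta> (Poly_Mapping.single A c) * Poly_Mapping.single B d +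
      Poly_Mapping.single A c * weight_op \<theta> (Poly_Mapping.single B d)" for A B c d
    by (simp add: mult_single weight_op_single algebra_simps flip: single_add)
  have expand: "weight_op \<theta> ((\<Sum>k\<in>K. Poly_Mapping.single k (c k)) * (\<Sum>l\<in>L. Poly_Mapping.single l (d l))) =
     weight_op \<theta> (\<Sum>k\<in>K. Poly_Mapping.single k (c k)) * (\<Sum>l\<in>L. Poly_Mapping.single l (d l)) +
     (\<Sum>k\<in>K. Poly_Mapping.single k (c k)) * weight_op \<theta> (\<Sum>l\<in>L. Poly_Mapping.single l (d l))"
    for K L :: "'v multiset set" and c d
    by (simp add: sum_product W.sum * sum.distrib)
  from expand[where K = "Poly_Mapping.keys p" and c = "Poly_Mapping.lookup p"
      and L = "Poly_Mapping.keys q" and d = "Poly_Mapping.lookup q"]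
  show ?thesis unfolding poly_mapping_sum_singles[symmetric] .
qed

lemma weight_op_coord_poly:
  assumes "Vector_Spaces.linear scale scale T" and "\<And>b. b \<in> Basis \<Longrightarrow> T b = scale (\<theta> b) b"
  shows "weight_op \<theta> (coord_poly v) = coord_poly (T v)"
proof -
  interpret T: Vector_Spaces.linear scale scale T by fact
  interpret W: Vector_Spaces.linear free_scale free_scale "weight_op \<theta>" by (rule linear_weight_op)
  have "v \<in> span Basis" by (simp add: span_Basis)
  then show ?thesis
  proof (induction rule: span_induct_alt)
    case base
    show ?case using coord_poly_scale[of 0 0] by (simp add: T.zero W.zero)
  next
    case (step c b v)
    then show ?case
      by (simp add: T.add T.scale W.add coord_poly_add coord_poly_scale coord_poly_basis assms(2)
          weight_op_single ac_simps)
  qed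
qed

lemma weight_op_prod_list:
  assumes "\<And>v. weight_op \<theta> (coord_poly v) = coord_poly (T v)"
  shows "weight_op \<theta> (prod_list (map coord_poly vs)) =
     (\<Sum>i<length vs. prod_list (map coord_poly (vs[i := T (vs ! i)])))"
proof (induction vs)
  case Nil
  show ?case by (rule poly_mapping_eqI) (auto simp: lookup_weight_op lookup_one when_def)
next
  case (Cons v vs)
  let ?P = "\<lambda>vs. prod_list (map coord_poly vs)"
  let ?S = "\<Sum>i<length vs. ?P (vs[i := T (vs ! i)])"
  have "weight_op \<theta> (?P (v # vs)) = weight_op \<theta> (coord_poly v * ?P vs)" by simp
  also have "\<dots> = coord_poly (T v) * ?P vs + coord_poly v * ?S"
    by (simp only: weight_op_mult assms Cons.IH)
  also have "coord_poly v * ?S = (\<Sum>i<length vs. ?P ((v # vs)[Suc i := T ((v # vs) ! Suc i)]))"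
    unfolding sum_distrib_left by simp
  also have "coord_poly (T v) * ?P vs = ?P ((v # vs)[0 := T ((v # vs) ! 0)])" by simp
  finally show ?case by (simp only: length_Cons sum.lessThan_Suc_shift)
qed

lemma sym_poly_action:
  assumes "Vector_Spaces.linear scale scale T" and "\<And>b. b \<in> Basis \<Longrightarrow> T b = scale (\<theta> b) b"
  shows "sym_poly (sym_action T w) = weight_op \<theta> (sym_poly w)"
proof -
  interpret W: Vector_Spaces.linear free_scale free_scale "weight_op \<theta>" by (rule linear_weight_op)
  have "sym_poly (sym_action T w) = (\<Sum>vs\<in>Poly_Mapping.keys w. free_scale (Poly_Mapping.lookup w vs)
      (\<Sum>i<length vs. prod_list (map coord_poly (vs[i := T (vs ! i)]))))"
    unfolding sym_action_def by (simp add: sym_poly.sum sym_poly_single free.scale_sum_right)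
  also have "\<dots> = (\<Sum>vs\<in>Poly_Mapping.keys w. free_scale (Poly_Mapping.lookup w vs)
      (weight_op \<theta> (prod_list (map coord_poly vs))))"
    by (intro sum.cong refl, subst weight_op_prod_list[OF weight_op_coord_poly[OF assms]]) auto
  also have "\<dots> = weight_op \<theta> (sym_poly w)"
    unfolding sym_poly_def linear_extension_def by (simp add: W.sum W.scale)
  finally show ?thesis .
qed

lemma sym_action_free_tuples:
  fixes w :: "'v list \<Rightarrow>\<^sub>0 complex"
  shows "w \<in> free_tuples N \<Longrightarrow> sym_action T w \<in> free_tuples N"
  unfolding sym_action_def
  by (intro free.subspace_sum[OF subspace_free_tuples] single_in_free_tuples) (auto simp: free_tuples_def)

text \<open>
  Under \<open>sym_poly\<close>, the action of \<open>h\<close> becomes a diagonal operator on polynomials, so a polynomial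
  has weight \<open>\<phi>\<close> exactly if all its monomials do. The tuples representing these monomials
  form a basis of the weight space modulo the relations.
\<close>

theorem sym_weight_mult_eq_card:
  assumes lin: "\<And>h. h \<in> H \<Longrightarrow> Vector_Spaces.linear scale scale (\<rho> h)"
    and eig: "\<And>h b. h \<in> H \<Longrightarrow> b \<in> Basis \<Longrightarrow> \<rho> h b = scale (\<theta> h b) b"
  shows "sym_weight_mult scale \<rho> H N \<phi> =
    card {M \<in> monomials N. \<forall>h\<in>H. (\<Sum>b\<in>#M. \<theta> h b) = \<phi> h}"
    (is "_ = card ?Ms")
proof -
  define U where "U = sym_weight_space_rep scale \<rho> H N \<phi>"
  define R where "R = sym_relations scale N"
  define E where "E = (\<lambda>k. Poly_Mapping.single k (1::complex)) ` (list_of_mset ` ?Ms)"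
  have fin: "finite ?Ms" using finite_monomials by auto
  have len: "length (list_of_mset M) = N" if "M \<in> monomials N" for M
    using that by (simp add: monomials_def flip: size_mset)
  have U_iff: "w \<in> U \<longleftrightarrow> w \<in> free_tuples N \<and>
      (\<forall>h\<in>H. weight_op (\<theta> h) (sym_poly w) = free_scale (\<phi> h) (sym_poly w))" for w
    unfolding U_def sym_weight_space_rep_def mem_Collect_eq sym_relations_iff
    using sym_poly_action[OF lin eig]
    by (auto simp: sym_poly.diff sym_poly.scale intro!: free.subspace_diff[OF subspace_free_tuples]
        free.subspace_scale[OF subspace_free_tuples] sym_action_free_tuples)
  have spanE: "free.span E = {w. Poly_Mapping.keys w \<subseteq> list_of_mset ` ?Ms}"
    unfolding E_def by (rule span_free_singles)
  have RU: "R \<subseteq> U"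
  proof
    interpret W: Vector_Spaces.linear free_scale free_scale "weight_op \<theta>'" for \<theta>'
      by (rule linear_weight_op)
    fix w assume "w \<in> R"
    then show "w \<in> U" unfolding U_iff R_def by (simp add: sym_relations_iff W.zero)
  qed
  have subU: "free.subspace U"
  proof -
    interpret W: Vector_Spaces.linear free_scale free_scale "weight_op \<theta>'" for \<theta>'
      by (rule linear_weight_op)
    show ?thesis
      by (rule free.subspaceI)
        (auto simp: U_iff sym_poly.add sym_poly.scale W.add W.scale W.zero sym_poly.zero
          free.scale_right_distrib free.subspace_0[OF subspace_free_tuples] mult.commute
          intro: free.subspace_add[OF subspace_free_tuples] free.subspace_scale[OF subspace_free_tuples])
  qed
  have EU: "E \<subseteq> U"
  proof
    fix w assume "w \<in> E"
    then obtain M where M: "M \<in> ?Ms" and w: "w = Poly_Mapping.single (list_of_mset M) 1"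
      by (auto simp: E_def)
    have "sym_poly w = Poly_Mapping.single M 1"
      unfolding w sym_poly_single using M
      by (subst prod_list_coord_poly_basis) (auto simp: monomials_def simp flip: set_mset_mset)
    then show "w \<in> U"
      using M len by (auto simp: U_iff w weight_op_single intro: single_in_free_tuples)
  qed
  have "quotient_dim free_scale U R = card E"
  proof (rule quotient_dim_eqI[OF vector_space_free_scale])
    show "free.subspace R" unfolding R_def by (rule subspace_sym_relations)
    show "finite E" using fin by (auto simp: E_def)
    show "E \<subseteq> U" by fact
    show "free.independent E" unfolding E_def by (rule independent_free_singles)
    show "free.span E \<inter> R = {0}"
    proof
      show "free.span E \<inter> R \<subseteq> {0}"
      proof
        fix w assume "w \<in> free.span E \<inter> R"
        then have "Poly_Mapping.keys w \<subseteq> list_of_mset ` monomials N" "sym_poly w = 0"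
          by (auto simp: spanE R_def sym_relations_iff)
        then show "w \<in> {0}" using normal_form_eq_0 by auto
      qed
      show "{0} \<subseteq> free.span E \<inter> R"
        using free.subspace_0[OF subspace_sym_relations] free.span_zero by (auto simp: R_def)
    qed
    show "free.span (E \<union> R) = U"
    proof
      show "free.span (E \<union> R) \<subseteq> U" using EU RU subU by (intro free.span_minimal) auto
      show "U \<subseteq> free.span (E \<union> R)"
      proof
        fix w assume w: "w \<in> U"
        then obtain w' where w': "Poly_Mapping.keys w' \<subseteq> list_of_mset ` monomials N" "w - w' \<in> R"
          using free_tuples_normal_form unfolding U_iff R_def by blast
        have eq: "sym_poly w' = sym_poly w"
          using w'(2) by (simp add: R_def sym_relations_iff sym_poly.diff)
        have "Poly_Mapping.keys w' \<subseteq> list_of_mset ` ?Ms"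
        proof
          fix k assume k: "k \<in> Poly_Mapping.keys w'"
          then obtain M where M: "M \<in> monomials N" "k = list_of_mset M" using w'(1) by auto
          then have nz: "Poly_Mapping.lookup (sym_poly w') M \<noteq> 0"
            using lookup_sym_poly_normal[OF w'(1) M(1)] k by (simp add: in_keys_iff)
          have "(\<Sum>b\<in>#M. \<theta> h b) = \<phi> h" if "h \<in> H" for h
          proof -
            have "Poly_Mapping.lookup (weight_op (\<theta> h) (sym_poly w')) M =
                Poly_Mapping.lookup (free_scale (\<phi> h) (sym_poly w')) M"
              using w that eq unfolding U_iff by simp
            then show ?thesis using nz by (simp add: lookup_weight_op)
          qed
          then show "k \<in> list_of_mset ` ?Ms" using M by auto
        qed
        then have "w' \<in> free.span (E \<union> R)"
          using free.span_mono[of E "E \<union> R"] by (auto simp: spanE)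
        moreover have "w - w' \<in> free.span (E \<union> R)" using w' by (auto intro: free.span_base)
        ultimately have "w' + (w - w') \<in> free.span (E \<union> R)" by (rule free.span_add)
        then show "w \<in> free.span (E \<union> R)" by simp
      qed
    qed
  qed
  also have "card E = card ?Ms"
  proof -
    have "inj_on (\<lambda>k. Poly_Mapping.single k (1::complex)) (list_of_mset ` ?Ms)"
      by (rule inj_onI) (metis keys_single one_neq_zero singleton_inject)
    then show ?thesis unfolding E_def by (simp add: card_image inj_list_of_mset)
  qed
  finally show ?thesis by (simp add: sym_weight_mult_def U_def R_def)
qed

lemma weight_mult_eq_card:
  assumes lin: "\<And>h. h \<in> H \<Longrightarrow> Vector_Spaces.linear scale scale (\<rho> h)"
    and eig: "\<And>h b. h \<in> H \<Longrightarrow> b \<in> Basis \<Longrightarrow> \<rho> h b = scale (\<theta> h b) b"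
  shows "weight_mult scale \<rho> H \<phi> = card {b \<in> Basis. \<forall>h\<in>H. \<theta> h b = \<phi> h}" (is "_ = card ?B")
proof -
  have "weight_space scale \<rho> H \<phi> \<subseteq> span ?B"
  proof
    fix v assume v: "v \<in> weight_space scale \<rho> H \<phi>"
    define c where "c = representation Basis v"
    have vc: "v = (\<Sum>b\<in>Basis. scale (c b) b)"
      using sum_representation_eq[OF independent_Basis _ finite_Basis, of v] by (simp add: c_def span_Basis)
    have "c b = 0" if b: "b \<in> Basis" "b \<notin> ?B" for b
    proof -
      obtain h where h: "h \<in> H" "\<theta> h b \<noteq> \<phi> h" using b by auto
      interpret T: Vector_Spaces.linear scale scale "\<rho> h" using lin h by blast
      have "\<rho> h v - scale (\<phi> h) v = 0" using v h by (auto simp: weight_space_def)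
      moreover have "\<rho> h v = (\<Sum>b\<in>Basis. scale (c b * \<theta> h b) b)"
        by (subst vc) (simp add: T.sum T.scale eig h(1))
      moreover have "scale (\<phi> h) v = (\<Sum>b\<in>Basis. scale (c b * \<phi> h) b)"
        by (subst vc) (simp add: scale_sum_right mult.commute)
      ultimately have "(\<Sum>b\<in>Basis. scale (c b * (\<theta> h b - \<phi> h)) b) = 0"
        by (simp add: right_diff_distrib scale_left_diff_distrib sum_subtractf)
      then have "c b * (\<theta> h b - \<phi> h) = 0"
        using dependent_finite[OF finite_Basis] independent_Basis b(1) by (auto dest!: spec[of _ "\<lambda>b. c b * (\<theta> h b - \<phi> h)"])
      then show ?thesis using h by simp
    qed
    then have "v = (\<Sum>b\<in>?B. scale (c b) b)"
      by (subst vc, intro sum.mono_neutral_right) (auto simp: finite_Basis)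
    also have "\<dots> \<in> span ?B" by (intro span_sum span_scale span_base)
    finally show "v \<in> span ?B" .
  qed
  moreover have "independent ?B" by (rule independent_mono[OF independent_Basis]) auto
  moreover have "?B \<subseteq> weight_space scale \<rho> H \<phi>" by (auto simp: weight_space_def eig)
  ultimately show ?thesis
    unfolding weight_mult_def by (intro dim_unique[of ?B]) auto
qed

end

section \<open>Weight multiplicities of symmetric powers as torus integrals\<close>

lemma weight_form_add: "weight_form \<omega> r (\<lambda>j. c j + d j) h = weight_form \<omega> r c h + weight_form \<omega> r d h"
  by (simp add: weight_form_def distrib_right sum.distrib)

text \<open>
  Evaluating at the coroots recovers the coordinates of a weight.
\<close>

lemma weight_form_eq_iff:
  assumes "\<And>j. j < r \<Longrightarrow> \<alpha>c j \<in> H" and "fundamental_weights s H r \<alpha>c \<omega>"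
    and "c \<in> weight_lattice r" "d \<in> weight_lattice r"
  shows "(\<forall>h\<in>H. weight_form \<omega> r c h = weight_form \<omega> r d h) \<longleftrightarrow> c = d"
proof
  assume eq: "\<forall>h\<in>H. weight_form \<omega> r c h = weight_form \<omega> r d h"
  have coord: "weight_form \<omega> r e (\<alpha>c j) = of_int (e j)" if j: "j < r" for e j
  proof -
    have "weight_form \<omega> r e (\<alpha>c j) = (\<Sum>i<r. if i = j then of_int (e j) else 0)"
      unfolding weight_form_def using assms(2) j
      by (intro sum.cong) (auto simp: fundamental_weights_def)
    then show ?thesis using j by simp
  qed
  show "c = d"
  proof
    fix j
    show "c j = d j"
    proof (cases "j < r")
      case True
      then show ?thesis using eq assms(1) coord[OF True, of c] coord[OF True, of d] by auto
    next
      case False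
      then show ?thesis using assms(3,4) by (simp add: weight_lattice_def)
    qed
  qed
qed simp

text \<open>
  Weight multiplicities that count the elements of a finite set \<open>A\<close> by their weights: sums and
  products over weights with multiplicity become sums and products over \<open>A\<close>. This is applied to the
  basis vectors of the representation and to the monomials of degree \<open>N\<close>.
\<close>

context
  fixes r :: nat and m :: "(nat \<Rightarrow> int) \<Rightarrow> nat" and A :: "'a set" and w :: "'a \<Rightarrow> nat \<Rightarrow> int"
  assumes fin: "finite A" and lattice: "\<And>a. a \<in> A \<Longrightarrow> w a \<in> weight_lattice r"
    and mult: "\<And>\<nu>. \<nu> \<in> weight_lattice r \<Longrightarrow> m \<nu> = card {a \<in> A. w a = \<nu>}"
begin

lemma weight_support_eq_image: "weight_support r m = w ` A"
proof -
  have "card {a \<in> A. w a = \<nu>} \<noteq> 0 \<longleftrightarrow> \<nu> \<in> w ` A" for \<nu>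
    using fin by (auto simp: card_eq_0_iff)
  then show ?thesis using lattice mult by (auto simp: weight_support_def)
qed

lemma character_eq_sum: "character r m q = (\<Sum>a\<in>A. qpow r q (w a))"
proof -
  have "(\<Sum>a\<in>A. qpow r q (w a)) = (\<Sum>\<nu>\<in>w ` A. \<Sum>a | a \<in> A \<and> w a = \<nu>. qpow r q (w a))"
    by (rule sum.image_gen[OF fin])
  also have "\<dots> = character r m q"
    unfolding character_def weight_support_eq_image using mult lattice by (intro sum.cong refl) auto
  finally show ?thesis by simp
qed

lemma prod_weight_support: "(\<Prod>\<nu>\<in>weight_support r m. g \<nu> ^ m \<nu>) = (\<Prod>a\<in>A. g (w a) :: 'c::comm_monoid_mult)"
proof -
  have "(\<Prod>a\<in>A. g (w a)) = (\<Prod>\<nu>\<in>w ` A. \<Prod>a | a \<in> A \<and> w a = \<nu>. g (w a))"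
    by (rule prod.image_gen[OF fin])
  also have "\<dots> = (\<Prod>\<nu>\<in>weight_support r m. g \<nu> ^ m \<nu>)"
    unfolding weight_support_eq_image using mult lattice by (intro prod.cong refl) auto
  finally show ?thesis by simp
qed

end

lemma partial_fraction_integrand_eq:
  assumes fin: "finite (weight_support r m)" and ne: "weight_support r m \<noteq> {}"
    and inj: "inj_on (qpow r q) (weight_support r m)" and q: "\<And>j. j < r \<Longrightarrow> q j \<noteq> 0"
  shows "(\<Sum>\<nu> \<in> weight_support r m. qpow r q \<nu> ^ N *
      (\<Sum>k = 1..m \<nu>. pf_coeff r m \<nu> k q * of_nat (p_poly k N))) =
    fps_nth (\<Prod>\<nu> \<in> weight_support r m. geometric_fps (qpow r q \<nu>) ^ m \<nu>) N"
proof -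
  have "qpow r q (- \<nu>) = 1 / qpow r q \<nu>" for \<nu>
    by (simp add: qpow_uminus divide_inverse)
  moreover have "\<exists>\<nu>\<in>weight_support r m. m \<nu> \<noteq> 0"
    using ne by (auto simp: weight_support_def)
  ultimately show ?thesis
    by (subst partial_fraction_power_series_coeff[OF fin inj qpow_nonzero[OF q]])
      (simp_all add: pf_coeff_def Let_def)
qed

lemma laurent_coeffs_shifted_character:
  assumes fin: "finite (weight_support r m)" and \<mu>: "\<mu> \<in> weight_lattice r"
  shows "laurent_coeffs r (\<lambda>q. qpow r q (- \<mu>) * character r m q) (\<lambda>c. of_nat (m (\<lambda>j. c j + \<mu> j)))"
proof -
  let ?sh = "\<lambda>\<nu> j. \<nu> j - \<mu> j"
  let ?a = "\<lambda>c. complex_of_nat (m (\<lambda>j. c j + \<mu> j))"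
  have supp: "{c \<in> weight_lattice r. ?a c \<noteq> 0} = ?sh ` weight_support r m"
  proof
    show "{c \<in> weight_lattice r. ?a c \<noteq> 0} \<subseteq> ?sh ` weight_support r m"
    proof
      fix c assume c: "c \<in> {c \<in> weight_lattice r. ?a c \<noteq> 0}"
      then have "(\<lambda>j. c j + \<mu> j) \<in> weight_support r m"
        using \<mu> by (auto simp: weight_support_def weight_lattice_def)
      moreover have "c = ?sh (\<lambda>j. c j + \<mu> j)" by simp
      ultimately show "c \<in> ?sh ` weight_support r m" by (intro image_eqI)
    qed
  qed (use \<mu> in \<open>auto simp: weight_support_def weight_lattice_def\<close>)
  have inj: "inj_on ?sh (weight_support r m)"
    by (rule inj_onI) (auto simp: fun_eq_iff)
  have "qpow r q (- \<mu>) * character r m q = (\<Sum>c\<in>?sh ` weight_support r m. ?a c * qpow r q c)"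
    if q: "\<forall>j<r. q j \<noteq> 0" for q
  proof -
    have "qpow r q (- \<mu>) * qpow r q \<nu> = qpow r q (?sh \<nu>)" for \<nu>
      using q by (simp add: qpow_diff qpow_uminus divide_inverse)
    then show ?thesis
      by (simp add: character_def sum_distrib_left sum.reindex[OF inj] mult.left_commute)
  qed
  then show ?thesis unfolding laurent_coeffs_def supp using fin by auto
qed

theorem corollary4p2:
  fixes scaleG :: "complex \<Rightarrow> 'g::ab_group_add \<Rightarrow> 'g"
    and bracket :: "'g \<Rightarrow> 'g \<Rightarrow> 'g"
    and H B :: "'g set"
    and r :: nat
    and \<alpha> \<omega> :: "nat \<Rightarrow> 'g \<Rightarrow> complex"
    and \<alpha>c :: "nat \<Rightarrow> 'g"
    and scaleV :: "complex \<Rightarrow> 'v::ab_group_add \<Rightarrow> 'v"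
    and \<rho> :: "'g \<Rightarrow> 'v \<Rightarrow> 'v"
    and lam \<mu> :: "nat \<Rightarrow> int"
    and N :: nat
    and m mN :: "(nat \<Rightarrow> int) \<Rightarrow> nat"
    and integrand :: "(nat \<Rightarrow> complex) \<Rightarrow> complex"
  assumes "semisimple_lie_algebra scaleG bracket"
    and "cartan_subalgebra scaleG bracket H"
    and "vector_space.dim scaleG H = r"
    and "borel_subalgebra scaleG bracket B" and "H \<subseteq> B"
    and "simple_roots scaleG bracket H B r \<alpha>"
    and "\<forall>j<r. is_coroot scaleG bracket H (\<alpha> j) (\<alpha>c j)"
    and "fundamental_weights scaleG H r \<alpha>c \<omega>"
    and "lie_representation scaleG bracket scaleV \<rho>"
    and "irreducible_rep scaleV \<rho>"
    and "lam \<in> weight_lattice r" and "dominant r lam"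
    and "has_highest_weight scaleG bracket H B scaleV \<rho> (weight_form \<omega> r lam)"
    and "m = (\<lambda>\<nu>. weight_mult scaleV \<rho> H (weight_form \<omega> r \<nu>))"
    and "mN = (\<lambda>\<nu>. sym_weight_mult scaleV \<rho> H N (weight_form \<omega> r \<nu>))"
    and "\<mu> \<in> weight_lattice r"
    and "integrand = (\<lambda>q. qpow r q (- \<mu>) *
           (\<Sum>\<nu> \<in> weight_support r m. qpow r q \<nu> ^ N *
             (\<Sum>k = 1..m \<nu>. pf_coeff r m \<nu> k q * of_nat (p_poly k N))))"
  shows "integrable (torus_measure r) (\<lambda>x. integrand (torus_point x)) \<and>
         of_nat (mN \<mu>) =
           1 / (2 * of_real pi) ^ r * (LINT x | torus_measure r. integrand (torus_point x)) \<and>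
         of_nat (mN \<mu>) = constant_term r (\<lambda>q. qpow r q (- \<mu>) * character r mN q)"
proof -
  have \<alpha>cH: "\<alpha>c j \<in> H" if "j < r" for j using assms(7) that by (simp add: is_coroot_def)
  have linV: "Vector_Spaces.linear scaleV scaleV (\<rho> h)" for h
    using assms(9) by (simp add: lie_representation_def)
  obtain Basis wt where "finite_dimensional_vector_space scaleV Basis"
    and wt: "\<And>b. b \<in> Basis \<Longrightarrow> wt b \<in> weight_lattice r"
    and eig: "\<And>h b. h \<in> H \<Longrightarrow> b \<in> Basis \<Longrightarrow> \<rho> h b = scaleV (weight_form \<omega> r (wt b) h) b"
  proof (rule weight_basis_exists[OF _ _ assms(2,3) _ assms(8,9,10)])
    show "lie_algebra scaleG bracket" "finite_dim scaleG"
      using assms(1) by (auto simp: semisimple_lie_algebra_def)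
    show "\<exists>v. v \<noteq> 0 \<and> v \<in> weight_space scaleV \<rho> H (weight_form \<omega> r lam)"
      using assms(13) by (auto simp: has_highest_weight_def)
  qed (use assms(7) in auto)
  then interpret complex_basis scaleV Basis by (simp add: complex_basis_def)
  define wts where "wts = (\<lambda>M j. \<Sum>b\<in>#M. wt b j)"
  have wts_empty: "wts {#} = (\<lambda>_. 0)" and wts_add: "wts (add_mset b M) = (\<lambda>j. wt b j + wts M j)" for b M
    by (simp_all add: wts_def)
  have wts: "wts M \<in> weight_lattice r" if "M \<in> monomials N" for M
    using that wt by (auto simp: wts_def weight_lattice_def monomials_def subset_iff intro!: sum_mset.neutral)
  have form_wts: "(\<Sum>b\<in>#M. weight_form \<omega> r (wt b) h) = weight_form \<omega> r (wts M) h" for M h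
    by (induction M) (simp_all add: wts_empty wts_add weight_form_add, simp add: weight_form_def)
  have qpow_wts: "qpow r q (wts M) = (\<Prod>b\<in>#M. qpow r q (wt b))" if "\<And>j. j < r \<Longrightarrow> q j \<noteq> 0" for q M
  proof (induction M)
    case (add b M)
    then show ?case
      using that by (simp add: wts_add qpow_def power_int_add prod.distrib)
  qed (simp add: wts_empty qpow_def)
  have m: "m \<nu> = card {b \<in> Basis. wt b = \<nu>}" if "\<nu> \<in> weight_lattice r" for \<nu>
  proof -
    have "m \<nu> = card {b \<in> Basis. \<forall>h\<in>H. weight_form \<omega> r (wt b) h = weight_form \<omega> r \<nu> h}"
      unfolding assms(14) by (intro weight_mult_eq_card linV eig)
    also have "{b \<in> Basis. \<forall>h\<in>H. weight_form \<omega> r (wt b) h = weight_form \<omega> r \<nu> h} = {b \<in> Basis. wt b = \<nu>}"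
      using weight_form_eq_iff[OF \<alpha>cH assms(8) wt that] by auto
    finally show ?thesis .
  qed
  have mN: "mN \<nu> = card {M \<in> monomials N. wts M = \<nu>}" if "\<nu> \<in> weight_lattice r" for \<nu>
  proof -
    have "mN \<nu> = card {M \<in> monomials N. \<forall>h\<in>H. (\<Sum>b\<in>#M. weight_form \<omega> r (wt b) h) = weight_form \<omega> r \<nu> h}"
      unfolding assms(15) by (intro sym_weight_mult_eq_card linV eig)
    also have "{M \<in> monomials N. \<forall>h\<in>H. (\<Sum>b\<in>#M. weight_form \<omega> r (wt b) h) = weight_form \<omega> r \<nu> h} =
        {M \<in> monomials N. wts M = \<nu>}"
      unfolding form_wts using weight_form_eq_iff[OF \<alpha>cH assms(8) wts that] by auto
    finally show ?thesis .
  qed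
  note supp_m = weight_support_eq_image[where m = m and w = wt, OF finite_Basis wt m]
  note supp_mN = weight_support_eq_image[where m = mN and w = wts, OF finite_monomials wts mN]
  have "Basis \<noteq> {}"
  proof
    assume "Basis = {}"
    then have "UNIV = {0 :: 'v}" using span_Basis by simp
    then show False using assms(10) by (auto simp: irreducible_rep_def)
  qed
  then have ne: "weight_support r m \<noteq> {}" using supp_m by simp
  have fin_m: "finite (weight_support r m)" using supp_m finite_Basis by simp
  have fin_mN: "finite (weight_support r mN)" using supp_mN finite_monomials by simp
  note laurent = laurent_coeffs_shifted_character[OF fin_mN assms(16)]
  have integrand: "integrand q = qpow r q (- \<mu>) * character r mN q"
    if inj: "inj_on (qpow r q) (weight_support r m)" and q: "\<And>j. j < r \<Longrightarrow> q j \<noteq> 0" for q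
  proof -
    have "fps_nth (\<Prod>\<nu> \<in> weight_support r m. geometric_fps (qpow r q \<nu>) ^ m \<nu>) N =
        fps_nth (\<Prod>b\<in>Basis. geometric_fps (qpow r q (wt b))) N"
      using prod_weight_support[where m = m and w = wt, OF finite_Basis wt m, of "\<lambda>\<nu>. geometric_fps (qpow r q \<nu>)"]
      by simp
    also have "\<dots> = complete_homogeneous (\<lambda>b. qpow r q (wt b)) Basis N"
      by (rule fps_nth_prod_geometric[OF finite_Basis])
    also have "\<dots> = (\<Sum>M\<in>monomials N. qpow r q (wts M))"
      by (simp add: complete_homogeneous_def monomials_def qpow_wts[OF q])
    also have "\<dots> = character r mN q"
      by (rule character_eq_sum[where m = mN and w = wts, OF finite_monomials wts mN, symmetric])
    finally show ?thesis
      by (simp only: assms(17) partial_fraction_integrand_eq[OF fin_m ne inj q])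
  qed
  have "AE x in torus_borel r. inj_on (qpow r (torus_point x)) (weight_support r m)"
    by (rule AE_torus_monomials_distinct[OF fin_m]) (auto simp: weight_support_def)
  then have ae: "AE x in torus_borel r. integrand (torus_point x) =
      qpow r (torus_point x) (- \<mu>) * character r mN (torus_point x)"
    by (rule eventually_mono) (simp add: integrand torus_point_nonzero)
  note int = torus_integral_AE[OF laurent ae]
  show ?thesis
  proof (intro conjI)
    show "integrable (torus_measure r) (\<lambda>x. integrand (torus_point x))" by (rule int(1))
    show "of_nat (mN \<mu>) = 1 / (2 * of_real pi) ^ r * (LINT x | torus_measure r. integrand (torus_point x))"
      unfolding int(2) by simp
    show "of_nat (mN \<mu>) = constant_term r (\<lambda>q. qpow r q (- \<mu>) * character r mN q)"
      using constant_term_eqI[OF laurent] by simp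
  qed
qed

end
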